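(* Assume $\mathcal M$ and $\partial\mathcal M$ are $C^\infty$. There exists a constant $C>0$ independent of $t$ such that for any $u\in L^2(\mathcal M)$ with $\int_{\mathcal M}u\,d\mu=0$ and any sufficiently small $t>0$, $$\langle u,L_tu\rangle_{\mathcal M}\ge C\|u\|^2_{L^2(\mathcal M)},$$ where $\langle f,g\rangle_{\mathcal M}=\int_{\mathcal M}fg\,d\mu$.
   Context: $\mathcal M$ is a compact $k$-dimensional submanifold of $\mathbb R^d$ with boundary $\partial\mathcal M$ a compact submanifold, with the induced metric and volume measure $\mu$. Kernel: $R:[0,\infty)\to[0,\infty)$ is $C^2$, $R(r)=0$ for $r>1$, $R(r)\ge\delta_0>0$ for $0\le r\le1/2$; $C_t=(4\pi t)^{-k/2}$, $R_t(\mathbf x,\mathbf y)=C_tR(|\mathbf x-\mathbf y|^2/(4t))$; $L_tu(\mathbf x)=\frac1t\int_{\mathcal M}R_t(\mathbf x,\mathbf y)(u(\mathbf x)-u(\mathbf y))d\mu_{\mathbf y}$.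
   Formalization: The manifold M is additionally assumed connected (and k ≥ 1): on a disconnected M, a mean-zero u that is constant on each component gives ⟨u, L_t u⟩ = 0 for small t, so the stated inequality fails. *)

theory Defs
  imports "HOL-Analysis.Analysis"
begin

fun dderiv :: "'a::real_normed_vector list \<Rightarrow> ('a \<Rightarrow> 'b::real_normed_vector) \<Rightarrow> 'a \<Rightarrow> 'b" where
  "dderiv [] f = f"
| "dderiv (v # vs) f = (\<lambda>x. frechet_derivative (dderiv vs f) (at x) v)"

definition smooth_on :: "'a::real_normed_vector set \<Rightarrow> ('a \<Rightarrow> 'b::real_normed_vector) \<Rightarrow> bool" where
  "smooth_on S f \<longleftrightarrow> (\<forall>vs. \<forall>x\<in>S. dderiv vs f differentiable (at x))"

definition half_space :: "'k::finite \<Rightarrow> (real^'k) set" where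
  "half_space i = {x. 0 \<le> x $ i}"

definition chart :: "(real^'d) set \<Rightarrow> (real^'k::finite) set \<Rightarrow> (real^'d) set \<Rightarrow> (real^'k \<Rightarrow> real^'d) \<Rightarrow> 'k \<Rightarrow> bool" where
  "chart M V U \<phi> i \<longleftrightarrow> open V \<and> open U \<and> smooth_on V \<phi> \<and>
     (\<forall>x\<in>V. inj (frechet_derivative \<phi> (at x))) \<and>
     (\<exists>\<psi>. homeomorphism (V \<inter> half_space i) (M \<inter> U) \<phi> \<psi>)"

definition smooth_submanifold_with_boundary :: "'k::finite itself \<Rightarrow> (real^'d) set \<Rightarrow> bool" where
  "smooth_submanifold_with_boundary _ M \<longleftrightarrow>
     (\<forall>p\<in>M. \<exists>(V::(real^'k) set) U \<phi> i. chart M V U \<phi> i \<and> p \<in> U)"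

definition jacobian_vol :: "(real^'k::finite \<Rightarrow> real^'d::finite) \<Rightarrow> real^'k \<Rightarrow> real" where
  "jacobian_vol \<phi> x =
     sqrt (det (transpose (matrix (frechet_derivative \<phi> (at x))) ** matrix (frechet_derivative \<phi> (at x))))"

text \<open>mu is the volume measure of M induced by the Euclidean metric: a Borel measure on R^d,
  concentrated on M, which in every local chart is given by the Gram-determinant density.
  (These properties determine mu uniquely.)\<close>
definition is_volume_measure :: "'k::finite itself \<Rightarrow> (real^'d) set \<Rightarrow> (real^'d) measure \<Rightarrow> bool" where
  "is_volume_measure _ M \<mu> \<longleftrightarrow>
     sets \<mu> = sets borel \<and> emeasure \<mu> (- M) = 0 \<and>
     (\<forall>(V::(real^'k) set) U \<phi> i A. chart M V U \<phi> i \<longrightarrow> A \<in> sets borel \<longrightarrow> A \<subseteq> M \<inter> U \<longrightarrow>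
        emeasure \<mu> A = (\<integral>\<^sup>+ x \<in> V \<inter> half_space i \<inter> \<phi> -` A. ennreal (jacobian_vol \<phi> x) \<partial>lborel))"

definition C_t :: "nat \<Rightarrow> real \<Rightarrow> real" where
  "C_t k t = (4 * pi * t) powr (- real k / 2)"

definition R_t :: "nat \<Rightarrow> (real \<Rightarrow> real) \<Rightarrow> real \<Rightarrow> 'a::real_normed_vector \<Rightarrow> 'a \<Rightarrow> real" where
  "R_t k R t x y = C_t k t * R ((norm (x - y))\<^sup>2 / (4 * t))"

definition L_t :: "nat \<Rightarrow> (real \<Rightarrow> real) \<Rightarrow> 'a::real_normed_vector measure \<Rightarrow> real \<Rightarrow> ('a \<Rightarrow> real) \<Rightarrow> 'a \<Rightarrow> real" where
  "L_t k R \<mu> t u x = (1 / t) * (\<integral>y. R_t k R t x y * (u x - u y) \<partial>\<mu>)"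

definition admissible_kernel :: "(real \<Rightarrow> real) \<Rightarrow> bool" where
  "admissible_kernel R \<longleftrightarrow>
     (\<exists>R' R''. (\<forall>r\<ge>0. (R has_real_derivative R' r) (at r within {0..}) \<and>
                        (R' has_real_derivative R'' r) (at r within {0..})) \<and>
               continuous_on {0..} R'') \<and>
     (\<forall>r\<ge>0. R r \<ge> 0) \<and> (\<forall>r>1. R r = 0) \<and>
     (\<exists>\<delta>0>0. \<forall>r. 0 \<le> r \<and> r \<le> 1/2 \<longrightarrow> R r \<ge> \<delta>0)"

end

theory Submission
  imports Defs
begin

text \<open>Up to a positive factor, \<open>\<langle>u, L_t u\<rangle>\<close> dominates \<open>t\<close> to the power \<open>- k/2 - 1\<close> times the
  integral of \<open>(u x - u y)\<^sup>2\<close> over all pairs with \<open>norm (x - y) \<le> sqrt (2 t)\<close>. On a convex parameter domain,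
  subdividing segments into about \<open>1 / sqrt t\<close> steps bounds the integral over all pairs by a constant
  times this quantity, and charts with Lipschitz parametrization and Jacobian bounded above and below carry the
  bound over to small patches of \<open>M\<close>. Overlapping patches are chained along the connected compact set \<open>M\<close>;
  for mean-zero \<open>u\<close> the integral over all pairs in \<open>M\<close> is \<open>2 * measure \<mu> M\<close> times the squared norm.\<close>

subsection \<open>Convex domains in Euclidean space\<close>

text \<open>The function \<open>u\<close> is only square integrable, so no derivative of it is
  available and its values at distant points can be compared only through intermediate values. The
  powers of \<open>t\<close> match by scaling: with \<open>n\<close> of order
  \<open>1 / sqrt t\<close> steps, the loss \<open>n ^ (k + 2)\<close> consists of one factor
  \<open>n\<close> from Cauchy-Schwarz, one from counting the steps, and \<open>n ^ k\<close> from
  rescaling displacements in dimension \<open>k\<close>; this is exactly the order of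
  \<open>C_t k t / t\<close>. The radius \<open>sqrt (2 * t)\<close> is the one at which the
  argument of \<open>R\<close> equals 1/2, the end of the range where \<open>R\<close> is bounded
  below. Chords of \<open>M\<close> leave \<open>M\<close> in general, so segments are drawn in
  chart domains: a ball cut with a half space is convex at interior and boundary points alike.
  Connectedness cannot be dropped: if \<open>M\<close> had two separated components, a nonzero
  mean-zero \<open>u\<close> constant on each would give \<open>L_t u = 0\<close> on
  \<open>M\<close> for all small \<open>t\<close>.\<close>

lemma nn_integral_lborel_translate:
  fixes f :: "'a::euclidean_space \<Rightarrow> ennreal"
  assumes [measurable]: "f \<in> borel_measurable borel"
  shows "(\<integral>\<^sup>+x. f (a + x) \<partial>lborel) = (\<integral>\<^sup>+x. f x \<partial>lborel)"
proof -
  have "(\<integral>\<^sup>+x. f x \<partial>lborel) = (\<integral>\<^sup>+x. f x \<partial>distr lborel borel ((+) a))"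
    by (simp add: lborel_distr_plus)
  also have "\<dots> = (\<integral>\<^sup>+x. f (a + x) \<partial>lborel)"
    by (subst nn_integral_distr) auto
  finally show ?thesis ..
qed

lemma nn_integral_lborel_scale:
  fixes f :: "'a::euclidean_space \<Rightarrow> ennreal"
  assumes [measurable]: "f \<in> borel_measurable borel" and c: "c > 0"
  shows "(\<integral>\<^sup>+x. f ((1 / c) *\<^sub>R x) \<partial>lborel) = ennreal (c ^ DIM('a)) * (\<integral>\<^sup>+x. f x \<partial>lborel)"
proof -
  have "(\<integral>\<^sup>+x. f ((1 / c) *\<^sub>R x) \<partial>lborel) =
      (\<integral>\<^sup>+x. f ((1 / c) *\<^sub>R x) \<partial>density (distr lborel borel (\<lambda>x::'a. 0 + c *\<^sub>R x)) (\<lambda>_. ennreal (\<bar>c\<bar> ^ DIM('a))))"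
    using lborel_affine[of c "0::'a"] c by simp
  also have "\<dots> = ennreal (c ^ DIM('a)) * (\<integral>\<^sup>+x. f x \<partial>lborel)"
    using c by (simp add: nn_integral_density nn_integral_distr nn_integral_cmult)
  finally show ?thesis .
qed

lemma square_telescope_le:
  fixes a :: "nat \<Rightarrow> real"
  shows "(a 0 - a n)\<^sup>2 \<le> real n * (\<Sum>j<n. (a j - a (Suc j))\<^sup>2)"
proof -
  have "(a 0 - a n)\<^sup>2 = (\<Sum>j<n. 1 * (a j - a (Suc j)))\<^sup>2"
    by (simp add: sum_lessThan_telescope')
  also have "\<dots> \<le> (\<Sum>j<n. 1\<^sup>2) * (\<Sum>j<n. (a j - a (Suc j))\<^sup>2)"
    by (rule Cauchy_Schwarz_ineq_sum)
  finally show ?thesis by simp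
qed

text \<open>Divide the segment from \<open>x\<close> to \<open>y\<close> into \<open>n\<close> equal steps. By Cauchy-Schwarz this costs a factor \<open>n\<close>
  and a sum of \<open>n\<close> terms; the substitution \<open>h = (y - x) / n\<close> accounts for \<open>n ^ DIM('a)\<close>.\<close>
lemma convex_nonlocal_poincare:
  fixes W :: "'a::euclidean_space set" and v :: "'a \<Rightarrow> real"
  assumes "convex W" and [measurable]: "W \<in> sets borel" "v \<in> borel_measurable borel"
    and n: "n > 0" and D: "\<And>x y. x \<in> W \<Longrightarrow> y \<in> W \<Longrightarrow> norm (x - y) \<le> D"
  shows "(\<integral>\<^sup>+x\<in>W. \<integral>\<^sup>+y\<in>W. ennreal ((v x - v y)\<^sup>2) \<partial>lborel \<partial>lborel) \<le>
    ennreal (real n ^ (DIM('a) + 2)) *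
    (\<integral>\<^sup>+x\<in>W. \<integral>\<^sup>+y\<in>W. ennreal ((v x - v y)\<^sup>2) * indicator {y. norm (x - y) \<le> D / real n} y \<partial>lborel \<partial>lborel)"
proof -
  \<comment> \<open>Displacement coordinates: \<open>w\<close> is \<open>y - x\<close> for the full
    segment, \<open>h\<close> is one step. The indicators sit inside the integrands so that
    translation, scaling and Fubini act on integrals over the whole space.\<close>
  define F where "F x w = indicator W x * (indicator W (x + w) * ennreal ((v x - v (x + w))\<^sup>2))" for x w
  define G where "G z h = indicator W z * (indicator W (z + h) *
    (indicator {h. norm h \<le> D / real n} h * ennreal ((v z - v (z + h))\<^sup>2)))" for z h
  have [measurable]: "case_prod F \<in> borel_measurable (borel \<Otimes>\<^sub>M borel)"
    "case_prod G \<in> borel_measurable (borel \<Otimes>\<^sub>M borel)"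
    unfolding F_def G_def by measurable
  \<comment> \<open>Convexity keeps all division points in \<open>W\<close>. The consecutive
    differences share the displacement \<open>w / n\<close> and differ only in the base
    point.\<close>
  have step: "F x w \<le> ennreal (real n) * (\<Sum>j<n. G ((real j / real n) *\<^sub>R w + x) ((1 / real n) *\<^sub>R w))" for x w
  proof (cases "x \<in> W \<and> x + w \<in> W")
    case False
    then show ?thesis by (auto simp: F_def)
  next
    case True
    define p where "p j = (real j / real n) *\<^sub>R w + x" for j
    have p0: "p 0 = x" and pn: "p n = x + w" using n by (auto simp: p_def)
    have pS: "p (Suc j) = p j + (1 / real n) *\<^sub>R w" for j
      by (simp add: p_def add_divide_distrib scaleR_add_left algebra_simps)
    have pW: "p j \<in> W" if "j \<le> n" for j
    proof -
      have "p j = (1 - real j / real n) *\<^sub>R x + (real j / real n) *\<^sub>R (x + w)"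
        by (simp add: p_def algebra_simps)
      then show ?thesis
        using True \<open>convex W\<close> that n by (auto intro!: convexD_alt[of W x "x + w", simplified])
    qed
    have "norm w \<le> D" using D[of "x + w" x] True by simp
    then have w: "norm ((1 / real n) *\<^sub>R w) \<le> D / real n"
      using n by (simp add: field_simps)
    have "F x w = ennreal ((v (p 0) - v (p n))\<^sup>2)"
      using True by (simp add: F_def p0 pn)
    also have "\<dots> \<le> ennreal (real n * (\<Sum>j<n. (v (p j) - v (p (Suc j)))\<^sup>2))"
      by (intro ennreal_leI square_telescope_le[of "\<lambda>j. v (p j)"])
    also have "\<dots> = ennreal (real n) * (\<Sum>j<n. ennreal ((v (p j) - v (p (Suc j)))\<^sup>2))"
      by (simp add: ennreal_mult sum_nonneg sum_ennreal)
    also have "(\<Sum>j<n. ennreal ((v (p j) - v (p (Suc j)))\<^sup>2)) =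
        (\<Sum>j<n. G (p j) ((1 / real n) *\<^sub>R w))"
    proof (intro sum.cong refl)
      fix j assume "j \<in> {..<n}"
      then have "p j \<in> W" "p (Suc j) \<in> W" by (auto intro!: pW)
      then show "ennreal ((v (p j) - v (p (Suc j)))\<^sup>2) = G (p j) ((1 / real n) *\<^sub>R w)"
        using w by (simp add: G_def pS)
    qed
    finally show ?thesis by (simp add: p_def)
  qed
  have "(\<integral>\<^sup>+x\<in>W. \<integral>\<^sup>+y\<in>W. ennreal ((v x - v y)\<^sup>2) \<partial>lborel \<partial>lborel) = (\<integral>\<^sup>+x. \<integral>\<^sup>+w. F x w \<partial>lborel \<partial>lborel)"
  proof (rule nn_integral_cong)
    fix x :: 'a
    have "(\<integral>\<^sup>+y\<in>W. ennreal ((v x - v y)\<^sup>2) \<partial>lborel) =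
      (\<integral>\<^sup>+w. ennreal ((v x - v (x + w))\<^sup>2) * indicator W (x + w) \<partial>lborel)"
      by (rule nn_integral_lborel_translate[symmetric]) measurable
    then show "(\<integral>\<^sup>+y\<in>W. ennreal ((v x - v y)\<^sup>2) \<partial>lborel) * indicator W x = (\<integral>\<^sup>+w. F x w \<partial>lborel)"
      unfolding F_def by (subst nn_integral_cmult) (auto simp: mult_ac)
  qed
  \<comment> \<open>With \<open>x\<close> innermost and \<open>w\<close> fixed, the \<open>n\<close>
    summands are translates of one function of \<open>x\<close> and have equal integrals; this gives
    the second factor \<open>n\<close>.\<close>
  also have "\<dots> = (\<integral>\<^sup>+w. \<integral>\<^sup>+x. F x w \<partial>lborel \<partial>lborel)"
    by (rule lborel_pair.Fubini'[symmetric]) measurable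
  also have "\<dots> \<le> (\<integral>\<^sup>+w. ennreal (real n * real n) * (\<integral>\<^sup>+z. G z ((1 / real n) *\<^sub>R w) \<partial>lborel) \<partial>lborel)"
  proof (rule nn_integral_mono)
    fix w :: 'a
    have "(\<integral>\<^sup>+x. F x w \<partial>lborel) \<le>
        (\<integral>\<^sup>+x. ennreal (real n) * (\<Sum>j<n. G ((real j / real n) *\<^sub>R w + x) ((1 / real n) *\<^sub>R w)) \<partial>lborel)"
      by (intro nn_integral_mono step)
    also have "\<dots> = ennreal (real n) *
        (\<Sum>j<n. \<integral>\<^sup>+x. G ((real j / real n) *\<^sub>R w + x) ((1 / real n) *\<^sub>R w) \<partial>lborel)"
      by (subst nn_integral_cmult) (auto simp: nn_integral_sum)
    also have "\<dots> = ennreal (real n) * (\<Sum>j<n. \<integral>\<^sup>+z. G z ((1 / real n) *\<^sub>R w) \<partial>lborel)"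
      by (intro arg_cong2[of _ _ _ _ "(*)"] refl sum.cong nn_integral_lborel_translate) measurable
    finally show "(\<integral>\<^sup>+x. F x w \<partial>lborel) \<le> ennreal (real n * real n) * (\<integral>\<^sup>+z. G z ((1 / real n) *\<^sub>R w) \<partial>lborel)"
      by (simp add: ennreal_mult ennreal_of_nat_eq_real_of_nat mult_ac)
  qed
  also have "\<dots> = ennreal (real n * real n) * (ennreal (real n ^ DIM('a)) * (\<integral>\<^sup>+h. \<integral>\<^sup>+z. G z h \<partial>lborel \<partial>lborel))"
    using n by (subst nn_integral_cmult)
      (auto intro!: arg_cong2[of _ _ _ _ "(*)"] nn_integral_lborel_scale)
  also have "\<dots> = ennreal (real n ^ (DIM('a) + 2)) * (\<integral>\<^sup>+h. \<integral>\<^sup>+z. G z h \<partial>lborel \<partial>lborel)"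
    by (simp add: ennreal_mult[symmetric] mult.assoc[symmetric] power_add power2_eq_square mult.commute)
  also have "(\<integral>\<^sup>+h. \<integral>\<^sup>+z. G z h \<partial>lborel \<partial>lborel) = (\<integral>\<^sup>+z. \<integral>\<^sup>+h. G z h \<partial>lborel \<partial>lborel)"
    by (rule lborel_pair.Fubini') measurable
  also have "\<dots> = (\<integral>\<^sup>+x\<in>W. \<integral>\<^sup>+y\<in>W. ennreal ((v x - v y)\<^sup>2) * indicator {y. norm (x - y) \<le> D / real n} y \<partial>lborel \<partial>lborel)"
  proof (rule nn_integral_cong)
    fix x :: 'a
    have "(\<integral>\<^sup>+y\<in>W. ennreal ((v x - v y)\<^sup>2) * indicator {y. norm (x - y) \<le> D / real n} y \<partial>lborel) =
      (\<integral>\<^sup>+w. (ennreal ((v x - v (x + w))\<^sup>2) * indicator {y. norm (x - y) \<le> D / real n} (x + w)) * indicator W (x + w) \<partial>lborel)"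
      by (rule nn_integral_lborel_translate[symmetric]) measurable
    also have "\<dots> * indicator W x = (\<integral>\<^sup>+h. G x h \<partial>lborel)"
      unfolding G_def
      by (subst nn_integral_cmult) (auto simp: mult_ac indicator_def intro!: arg_cong2[of _ _ _ _ "(*)"] nn_integral_cong)
    finally show "(\<integral>\<^sup>+h. G x h \<partial>lborel) = 
      (\<integral>\<^sup>+y\<in>W. ennreal ((v x - v y)\<^sup>2) * indicator {y. norm (x - y) \<le> D / real n} y \<partial>lborel) * indicator W x" ..
  qed
  finally show ?thesis .
qed

subsection \<open>Local parametrizations\<close>

text \<open>Along the segment from the identity to the Gram matrix every matrix is positive
  definite, hence invertible. The determinant is continuous, starts at 1 and never vanishes, so it
  stays positive by the intermediate value theorem.\<close>

lemma det_gram_pos: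
  fixes A :: "real^'k^'d"
  assumes "inj ((*v) A)"
  shows "0 < det (transpose A ** A)"
proof -
  define B where "B s = (1 - s) *\<^sub>R mat 1 + s *\<^sub>R (transpose A ** A)" for s
  have "continuous_on {0..1} (\<lambda>s. det (B s))"
    unfolding det_def B_def by (intro continuous_intros)
  moreover have nz: "det (B s) \<noteq> 0" if s: "s \<in> {0..1}" for s
  proof -
    have "x = 0" if x: "B s *v x = 0" for x
    proof (rule ccontr)
      assume "x \<noteq> 0"
      then have "A *v x \<noteq> 0"
        using assms injD[of "(*v) A" x 0] by auto
      have "0 = x \<bullet> (B s *v x)" using x by simp
      also have "\<dots> = (1 - s) * (x \<bullet> x) + s * ((A *v x) \<bullet> (A *v x))"
        by (simp add: B_def matrix_vector_mult_add_rdistrib scaleR_matrix_vector_assoc[symmetric]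
            inner_add_right matrix_vector_mul_assoc[symmetric] dot_matrix_vector_mul
            vector_transpose_matrix dot_lmul_matrix[symmetric] inner_commute)
      also have "\<dots> > 0"
        using s \<open>x \<noteq> 0\<close> \<open>A *v x \<noteq> 0\<close>
        by (cases "s = 0") (auto intro!: add_nonneg_pos)
      finally show False by simp
    qed
    then show ?thesis
      using invertible_det_nz[of "B s"] matrix_left_invertible_ker[of "B s"]
      by (auto simp: invertible_left_inverse)
  qed
  ultimately have "\<not> det (B 1) \<le> 0"
    using IVT2'[of "\<lambda>s. det (B s)" 1 0 0] by (force simp: B_def)
  then show ?thesis by (simp add: B_def)
qed

lemma
  fixes \<phi> :: "'a::euclidean_space \<Rightarrow> 'b::euclidean_space"
  assumes "smooth_on V \<phi>"
  shows smooth_on_has_derivative: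
      "x \<in> V \<Longrightarrow> (\<phi> has_derivative frechet_derivative \<phi> (at x)) (at x)"
    and smooth_on_continuous_on: "continuous_on V \<phi>"
    and smooth_on_continuous_on_derivative: "continuous_on V (\<lambda>x. frechet_derivative \<phi> (at x) v)"
proof -
  \<comment> \<open>Direction lists of length zero and one express that \<phi> is continuously
    differentiable.\<close>
  have "dderiv [] \<phi> differentiable at x" "dderiv [v] \<phi> differentiable at x" if "x \<in> V" for x v
    using assms that unfolding smooth_on_def by blast+
  then have *: "\<phi> differentiable at x" "(\<lambda>x. frechet_derivative \<phi> (at x) v) differentiable at x"
    if "x \<in> V" for x v
    using that by simp_all
  then show "x \<in> V \<Longrightarrow> (\<phi> has_derivative frechet_derivative \<phi> (at x)) (at x)"
    by (simp add: frechet_derivative_works)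
  show "continuous_on V \<phi>" "continuous_on V (\<lambda>x. frechet_derivative \<phi> (at x) v)"
    using * by (meson continuous_at_imp_continuous_on differentiable_imp_continuous_within)+
qed

lemma continuous_on_jacobian_vol:
  assumes "smooth_on V \<phi>"
  shows "continuous_on V (jacobian_vol \<phi>)"
  unfolding jacobian_vol_def[abs_def] det_def matrix_def matrix_matrix_mult_def transpose_def
  by (auto intro!: continuous_intros smooth_on_continuous_on_derivative[OF assms])

lemma jacobian_vol_pos:
  assumes "smooth_on V \<phi>" "x \<in> V" "inj (frechet_derivative \<phi> (at x))"
  shows "0 < jacobian_vol \<phi> x"
proof -
  have "linear (frechet_derivative \<phi> (at x))"
    using smooth_on_has_derivative[OF assms(1,2)] has_derivative_linear by blast
  then show ?thesis
    unfolding jacobian_vol_def using assms(3) by (simp add: det_gram_pos matrix_works)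
qed

text \<open>The bound is continuous in the base point as soon as the directional derivatives are, so
  a uniform bound on operator norms follows without treating the derivative as an operator-valued
  map.\<close>

lemma onorm_le_sum_Basis:
  fixes f :: "'a::euclidean_space \<Rightarrow> 'b::real_normed_vector"
  assumes "linear f"
  shows "onorm f \<le> (\<Sum>b\<in>Basis. norm (f b))"
proof (rule onorm_le)
  fix x :: 'a
  have "f x = f (\<Sum>b\<in>Basis. (x \<bullet> b) *\<^sub>R b)" by (simp add: euclidean_representation)
  also have "\<dots> = (\<Sum>b\<in>Basis. (x \<bullet> b) *\<^sub>R f b)"
    using assms by (simp add: linear_sum linear_scale)
  finally have "norm (f x) \<le> (\<Sum>b\<in>Basis. norm ((x \<bullet> b) *\<^sub>R f b))"
    by (metis norm_sum)
  also have "\<dots> \<le> (\<Sum>b\<in>Basis. norm x * norm (f b))"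
    by (auto intro!: sum_mono mult_right_mono Basis_le_norm)
  finally show "norm (f x) \<le> (\<Sum>b\<in>Basis. norm (f b)) * norm x"
    by (simp add: sum_distrib_left mult.commute)
qed

lemma smooth_on_Lipschitz_convex_compact:
  fixes \<phi> :: "'a::euclidean_space \<Rightarrow> 'b::euclidean_space"
  assumes "smooth_on V \<phi>" "convex K" "compact K" "K \<subseteq> V"
  obtains L where "L > 0" "\<And>x y. x \<in> K \<Longrightarrow> y \<in> K \<Longrightarrow> norm (\<phi> x - \<phi> y) \<le> L * norm (x - y)"
proof -
  define g where "g x = (\<Sum>b\<in>Basis. norm (frechet_derivative \<phi> (at x) b))" for x
  have "continuous_on K g"
    unfolding g_def by (intro continuous_intros
        continuous_on_subset[OF smooth_on_continuous_on_derivative[OF assms(1)] assms(4)])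
  then have "bounded (g ` K)"
    using assms(3) compact_continuous_image compact_imp_bounded by blast
  then obtain L where "L > 0" and L: "\<And>x. x \<in> K \<Longrightarrow> norm (g x) \<le> L"
    unfolding bounded_pos by auto
  show thesis
  proof (rule that[OF \<open>L > 0\<close>])
    fix x y assume "x \<in> K" "y \<in> K"
    show "norm (\<phi> x - \<phi> y) \<le> L * norm (x - y)"
    proof (rule differentiable_bound[OF assms(2) _ _ \<open>x \<in> K\<close> \<open>y \<in> K\<close>])
      fix z assume z: "z \<in> K"
      have der: "(\<phi> has_derivative frechet_derivative \<phi> (at z)) (at z)"
        using smooth_on_has_derivative[OF assms(1)] z assms(4) by blast
      then show "(\<phi> has_derivative frechet_derivative \<phi> (at z)) (at z within K)"
        by (rule has_derivative_at_withinI)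
      show "onorm (frechet_derivative \<phi> (at z)) \<le> L"
        using onorm_le_sum_Basis[OF has_derivative_linear[OF der]] L[OF z] by (simp add: g_def)
    qed
  qed
qed

text \<open>\<open>is_volume_measure\<close> speaks of measures of sets only. The change of
  variables for integrals comes from identifying two measures: \<mu> restricted to the patch, and
  the push-forward of the Jacobian density. \<open>f\<close> and \<open>J\<close> stand in for
  \<phi> and its Jacobian because those are controlled only on \<open>V\<close>, while the
  push-forward needs globally Borel maps.\<close>

lemma nn_integral_volume_measure_chart:
  fixes M :: "(real^'d) set" and \<phi> :: "real^'k \<Rightarrow> real^'d"
  assumes vol: "is_volume_measure TYPE('k) M \<mu>" and ch: "chart M V U \<phi> i"
    and W: "W \<in> sets borel" "W \<subseteq> V \<inter> half_space i" and Q: "\<phi> ` W \<in> sets borel"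
    and f [measurable]: "f \<in> borel_measurable borel" and f\<phi>: "\<And>x. x \<in> W \<Longrightarrow> f x = \<phi> x"
    and J [measurable]: "J \<in> borel_measurable borel" and J\<phi>: "\<And>x. x \<in> W \<Longrightarrow> J x = jacobian_vol \<phi> x"
    and g [measurable]: "g \<in> borel_measurable borel"
  shows "(\<integral>\<^sup>+x\<in>\<phi> ` W. g x \<partial>\<mu>) = (\<integral>\<^sup>+x\<in>W. g (f x) * ennreal (J x) \<partial>lborel)"
proof -
  note [measurable] = W(1) Q
  have [measurable_cong]: "sets \<mu> = sets borel" using vol by (simp add: is_volume_measure_def)
  obtain \<psi> where hom: "homeomorphism (V \<inter> half_space i) (M \<inter> U) \<phi> \<psi>"
    using ch by (auto simp: chart_def)
  let ?j = "\<lambda>x. indicator W x * ennreal (J x)"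
  have "density \<mu> (indicator (\<phi> ` W)) = distr (density lborel ?j) borel f"
  proof (rule measure_eqI)
    fix A assume "A \<in> sets (density \<mu> (indicator (\<phi> ` W)))"
    then have A [measurable]: "A \<in> sets borel" using \<open>sets \<mu> = sets borel\<close> by simp
    have "emeasure (density \<mu> (indicator (\<phi> ` W))) A = emeasure \<mu> (\<phi> ` W \<inter> A)"
      by (subst emeasure_density) (auto simp: indicator_inter_arith[symmetric])
    also have "\<dots> = (\<integral>\<^sup>+ x \<in> V \<inter> half_space i \<inter> \<phi> -` (\<phi> ` W \<inter> A). ennreal (jacobian_vol \<phi> x) \<partial>lborel)"
    proof -
      have "\<phi> ` W \<inter> A \<in> sets borel" by measurable
      moreover have "\<phi> ` W \<inter> A \<subseteq> M \<inter> U"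
        using W(2) homeomorphism_image1[OF hom] by blast
      ultimately show ?thesis
        using vol ch unfolding is_volume_measure_def by blast
    qed
    \<comment> \<open>Injectivity of \<phi> on the chart domain: a point mapped into the image of
      \<open>W\<close> lies in \<open>W\<close>.\<close>
    also have "V \<inter> half_space i \<inter> \<phi> -` (\<phi> ` W \<inter> A) = W \<inter> \<phi> -` A"
      using homeomorphism_apply1[OF hom] W(2) by (auto simp: subset_iff) (metis IntI)
    also have "(\<integral>\<^sup>+ x \<in> W \<inter> \<phi> -` A. ennreal (jacobian_vol \<phi> x) \<partial>lborel) = (\<integral>\<^sup>+x. ?j x * indicator (f -` A) x \<partial>lborel)"
      using f\<phi> J\<phi> by (intro nn_integral_cong) (auto simp: indicator_def)
    also have "\<dots> = emeasure (distr (density lborel ?j) borel f) A"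
      using measurable_sets[OF f A] by (simp add: emeasure_distr emeasure_density)
    finally show "emeasure (density \<mu> (indicator (\<phi> ` W))) A = emeasure (distr (density lborel ?j) borel f) A" .
  qed (simp add: \<open>sets \<mu> = sets borel\<close>)
  then have "integral\<^sup>N (density \<mu> (indicator (\<phi> ` W))) g = integral\<^sup>N (distr (density lborel ?j) borel f) g"
    by simp
  then show ?thesis
    by (simp add: nn_integral_density nn_integral_distr mult_ac)
qed

lemma convex_half_space: "convex (half_space i)"
proof -
  have "half_space i = {x. 0 \<le> axis i 1 \<bullet> x}"
    by (simp add: half_space_def inner_axis')
  then show ?thesis using convex_halfspace_ge[of 0 "axis i 1"] by simp
qed

lemma closed_half_space: "closed (half_space i)"
  unfolding half_space_def by (intro closed_Collect_le continuous_intros)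

lemma emeasure_lborel_ball_half_space_pos:
  fixes x :: "real^'k"
  assumes "x \<in> half_space i" "r > 0"
  shows "0 < emeasure lborel (ball x r \<inter> half_space i)"
proof -
  \<comment> \<open>Moving the centre inward by half the radius leaves a ball that fits in the half
    space even when \<open>x\<close> is on the boundary hyperplane.\<close>
  define c where "c = x + (r / 2) *\<^sub>R axis i 1"
  have "ball c (r / 2) \<subseteq> ball x r \<inter> half_space i"
  proof
    fix y assume y: "y \<in> ball c (r / 2)"
    have "dist x c = r / 2" using \<open>r > 0\<close> by (simp add: c_def dist_norm)
    then have "dist x y < r" using y dist_triangle[of x y c] by simp
    moreover have "\<bar>(c - y) $ i\<bar> < r / 2"
      using y component_le_norm_cart[of "c - y" i] by (simp add: dist_norm)
    then have "0 \<le> y $ i" using assms(1) by (simp add: c_def half_space_def abs_if split: if_splits)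
    ultimately show "y \<in> ball x r \<inter> half_space i" by (simp add: half_space_def)
  qed
  then have "emeasure lborel (ball c (r / 2)) \<le> emeasure lborel (ball x r \<inter> half_space i)"
    using closed_half_space[of i] by (intro emeasure_mono) auto
  moreover have "0 < emeasure lborel (ball c (r / 2))"
    using content_ball_pos[of "r / 2" c] \<open>r > 0\<close> by (simp add: measure_def enn2real_positive_iff)
  ultimately show ?thesis by order
qed

text \<open>Everything that the later estimates use of a chart, so that charts need not be opened
  again. The open set \<open>T\<close> allows patches to be taken arbitrarily small.\<close>

lemma local_parametrization:
  fixes M :: "(real^'d) set" and \<mu> :: "(real^'d) measure"
  assumes "smooth_submanifold_with_boundary TYPE('k::finite) M" "M \<in> sets borel"
    and vol: "is_volume_measure TYPE('k) M \<mu>"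
    and p: "p \<in> M" "p \<in> T" "open T"
  obtains W :: "(real^'k) set" and f and J and D L a b
  where "convex W" "W \<in> sets borel" "0 < D" "\<And>x y. x \<in> W \<Longrightarrow> y \<in> W \<Longrightarrow> norm (x - y) \<le> D"
    "0 < emeasure lborel W" "emeasure lborel W < \<infinity>"
    "p \<in> f ` W" "f ` W \<subseteq> T" "openin (top_of_set M) (f ` W)" "f ` W \<in> sets borel"
    "f \<in> borel_measurable borel" "J \<in> borel_measurable borel"
    "0 < L" "\<And>x y. x \<in> W \<Longrightarrow> y \<in> W \<Longrightarrow> norm (f x - f y) \<le> L * norm (x - y)"
    "0 < a" "\<And>x. x \<in> W \<Longrightarrow> a \<le> J x" "\<And>x. x \<in> W \<Longrightarrow> J x \<le> b"
    "\<And>g. g \<in> borel_measurable borel \<Longrightarrow>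
      (\<integral>\<^sup>+x\<in>f ` W. g x \<partial>\<mu>) = (\<integral>\<^sup>+x\<in>W. g (f x) * ennreal (J x) \<partial>lborel)"
proof -
  obtain V :: "(real^'k) set" and U \<phi> i where ch: "chart M V U \<phi> i" and "p \<in> U"
    using assms(1) p(1) unfolding smooth_submanifold_with_boundary_def by blast
  then obtain \<psi> where hom: "homeomorphism (V \<inter> half_space i) (M \<inter> U) \<phi> \<psi>"
    and "open V" "open U" and sm: "smooth_on V \<phi>"
    and inj: "\<And>x. x \<in> V \<Longrightarrow> inj (frechet_derivative \<phi> (at x))"
    by (auto simp: chart_def)
  have "p \<in> \<phi> ` (V \<inter> half_space i)"
    using hom p(1) \<open>p \<in> U\<close> by (auto simp: homeomorphism_def)
  then obtain x0 where x0: "x0 \<in> V" "x0 \<in> half_space i" "p = \<phi> x0" by auto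
  have "open (V \<inter> \<phi> -` T)"
    using smooth_on_continuous_on[OF sm] \<open>open V\<close> \<open>open T\<close> by (simp add: continuous_open_preimage)
  \<comment> \<open>A closed ball inside \<open>V\<close> provides the compactness for the Lipschitz
    constant and the two Jacobian bounds, whereas \<open>W\<close> uses the open ball so that its
    image is open in \<open>M\<close>.\<close>
  then obtain r where "r > 0" and r: "cball x0 r \<subseteq> V \<inter> \<phi> -` T"
    using x0 p(2) unfolding open_contains_cball by (metis IntI vimageI)
  define W where "W = ball x0 r \<inter> half_space i"
  \<comment> \<open>The default value 0 off \<open>W\<close> makes the functions Borel on the whole
    space, since nothing is known about \<phi> outside \<open>V\<close>.\<close>
  define f where "f x = (if x \<in> W then \<phi> x else 0)" for x
  define J where "J x = (if x \<in> W then jacobian_vol \<phi> x else 0)" for x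
  have WK: "W \<subseteq> cball x0 r" and WV: "W \<subseteq> V \<inter> half_space i" and x0W: "x0 \<in> W"
    using r x0 \<open>r > 0\<close> by (auto simp: W_def)
  have im: "f ` W = \<phi> ` W" by (auto simp: f_def)
  have W_borel: "W \<in> sets borel"
    unfolding W_def using closed_half_space[of i] by auto
  have "openin (top_of_set (V \<inter> half_space i)) (V \<inter> half_space i \<inter> ball x0 r)"
    by (simp add: openin_open_Int)
  moreover have "V \<inter> half_space i \<inter> ball x0 r = W" using r by (auto simp: W_def)
  ultimately have "openin (top_of_set (M \<inter> U)) (\<phi> ` W)"
    using homeomorphism_imp_open_map[OF hom] by auto
  then have op: "openin (top_of_set M) (\<phi> ` W)"
    using \<open>open U\<close> openin_open_Int openin_trans by blast
  then obtain O' where "open O'" "\<phi> ` W = M \<inter> O'" by (auto simp: openin_open)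
  then have Q_borel: "\<phi> ` W \<in> sets borel" using \<open>M \<in> sets borel\<close> by simp
  obtain L where L: "L > 0" "\<And>x y. x \<in> cball x0 r \<Longrightarrow> y \<in> cball x0 r \<Longrightarrow> norm (\<phi> x - \<phi> y) \<le> L * norm (x - y)"
    using smooth_on_Lipschitz_convex_compact[OF sm, of "cball x0 r"] r by auto
  have contJ: "continuous_on (cball x0 r) (jacobian_vol \<phi>)"
    using continuous_on_jacobian_vol[OF sm] r by (auto intro: continuous_on_subset)
  obtain x1 where x1: "x1 \<in> cball x0 r" "\<And>x. x \<in> cball x0 r \<Longrightarrow> jacobian_vol \<phi> x1 \<le> jacobian_vol \<phi> x"
    using continuous_attains_inf[OF _ _ contJ] \<open>r > 0\<close> by auto
  obtain x2 where x2: "x2 \<in> cball x0 r" "\<And>x. x \<in> cball x0 r \<Longrightarrow> jacobian_vol \<phi> x \<le> jacobian_vol \<phi> x2"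
    using continuous_attains_sup[OF _ _ contJ] \<open>r > 0\<close> by auto
  have f_borel: "f \<in> borel_measurable borel" unfolding f_def
    using WV by (intro borel_measurable_continuous_on_if W_borel continuous_on_const
        continuous_on_subset[OF smooth_on_continuous_on[OF sm]]) auto
  have J_borel: "J \<in> borel_measurable borel" unfolding J_def
    using WK by (intro borel_measurable_continuous_on_if W_borel continuous_on_const
        continuous_on_subset[OF contJ])
  show thesis
  proof (rule that[of W "2 * r" f J L "jacobian_vol \<phi> x1" "jacobian_vol \<phi> x2"])
    show "convex W" unfolding W_def by (intro convex_Int convex_ball convex_half_space)
    show "norm (x - y) \<le> 2 * r" if "x \<in> W" "y \<in> W" for x y
      using that dist_triangle3[of x y x0] by (auto simp: W_def dist_norm)
    show "0 < emeasure lborel W"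
      unfolding W_def by (rule emeasure_lborel_ball_half_space_pos[OF x0(2) \<open>r > 0\<close>])
    show "emeasure lborel W < \<infinity>"
      using emeasure_mono[of W "ball x0 r" lborel] emeasure_lborel_ball_finite[of x0 r]
      by (auto simp: W_def)
    show "0 < jacobian_vol \<phi> x1"
      using x1(1) r inj by (intro jacobian_vol_pos[OF sm]) auto
    show "norm (f x - f y) \<le> L * norm (x - y)" if "x \<in> W" "y \<in> W" for x y
      using that L(2)[OF subsetD[OF WK] subsetD[OF WK]] by (simp add: f_def)
    show "(\<integral>\<^sup>+x\<in>f ` W. g x \<partial>\<mu>) = (\<integral>\<^sup>+x\<in>W. g (f x) * ennreal (J x) \<partial>lborel)"
      if "g \<in> borel_measurable borel" for g
      unfolding im using that
      by (intro nn_integral_volume_measure_chart[OF vol ch W_borel WV Q_borel f_borel _ J_borel])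
        (auto simp: f_def J_def)
  qed (use \<open>r > 0\<close> W_borel f_borel J_borel L(1) op Q_borel im x0W x0 r WK x1 x2 in \<open>auto simp: J_def\<close>)
qed

subsection \<open>Transfer to patches\<close>

definition sq_osc :: "'a measure \<Rightarrow> ('a \<Rightarrow> real) \<Rightarrow> 'a set \<Rightarrow> 'a set \<Rightarrow> ennreal" where
  "sq_osc \<mu> u A B = (\<integral>\<^sup>+x\<in>A. \<integral>\<^sup>+y\<in>B. ennreal ((u x - u y)\<^sup>2) \<partial>\<mu> \<partial>\<mu>)"

text \<open>The cutoff selects the pairs with \<open>(norm (x - y))\<^sup>2 / (4 * t)\<close> at
  most 1/2, where the kernel is at least a constant times \<open>C_t k t\<close>.\<close>

definition near_osc :: "'a::real_normed_vector measure \<Rightarrow> real \<Rightarrow> ('a \<Rightarrow> real) \<Rightarrow> ennreal" where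
  "near_osc \<mu> t u =
    (\<integral>\<^sup>+x. \<integral>\<^sup>+y. ennreal ((u x - u y)\<^sup>2) * indicator {y. (norm (x - y))\<^sup>2 \<le> 2 * t} y \<partial>\<mu> \<partial>\<mu>)"

text \<open>The right-hand side does not mention the sets, so estimates for different pairs of sets
  can be added and chained. Values in \<open>ennreal\<close> allow every Borel \<open>u\<close>,
  without integrability conditions; the constants are uniform in \<open>u\<close> and
  \<open>t\<close>.\<close>

definition controlled :: "nat \<Rightarrow> 'a::euclidean_space measure \<Rightarrow> 'a set \<Rightarrow> 'a set \<Rightarrow> bool" where
  "controlled k \<mu> A B \<longleftrightarrow> (\<exists>C\<ge>0. \<exists>t0>0. \<forall>t. 0 < t \<and> t < t0 \<longrightarrow>
     (\<forall>u\<in>borel_measurable borel. sq_osc \<mu> u A B \<le> ennreal (C * C_t k t / t) * near_osc \<mu> t u))"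

lemma C_t_pos: "t > 0 \<Longrightarrow> 0 < C_t k t"
  by (simp add: C_t_def)

text \<open>Converts the loss from subdividing into steps of size \<open>sqrt (2 * t)\<close> into
  the normalization of the kernel; the power of \<open>2 * pi\<close> comes from splitting
  \<open>4 * pi * t\<close> as \<open>2 * pi\<close> times \<open>2 * t\<close>.\<close>

lemma inverse_sqrt_power_eq_C_t:
  assumes "t > 0"
  shows "(1 / sqrt (2 * t)) ^ (k + 2) = (2 * pi) powr (real k / 2) / 2 * C_t k t / t"
proof -
  have "(1 / sqrt (2 * t)) ^ k = (2 * t) powr (- real k / 2)"
    using assms by (simp add: powr_minus powr_half_sqrt[symmetric] powr_powr[symmetric]
        power_one_over inverse_eq_divide powr_realpow[symmetric] powr_powr)
  also have "\<dots> = (2 * pi) powr (real k / 2) * C_t k t"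
  proof -
    have "C_t k t = (2 * pi) powr (- real k / 2) * (2 * t) powr (- real k / 2)"
      using assms by (simp add: C_t_def powr_mult[symmetric] mult.assoc)
    moreover have "(2 * pi) powr (real k / 2) * (2 * pi) powr (- real k / 2) = 1"
      by (simp add: powr_add[symmetric])
    ultimately show ?thesis by (metis mult.assoc mult_1)
  qed
  finally have "(1 / sqrt (2 * t)) ^ k = (2 * pi) powr (real k / 2) * C_t k t" .
  moreover have "(1 / sqrt (2 * t)) ^ 2 = 1 / (2 * t)"
    using assms by (simp add: power_divide)
  ultimately show ?thesis by (simp only: power_add) simp
qed

lemma nn_integral_set_mono:
  "(\<And>x. x \<in> A \<Longrightarrow> f x \<le> g x) \<Longrightarrow> (\<integral>\<^sup>+x\<in>A. f x \<partial>M) \<le> (\<integral>\<^sup>+x\<in>A. g x \<partial>M)"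
  by (intro nn_integral_mono) (auto simp: indicator_def)

lemma nn_integral_set_cmult:
  assumes "f \<in> borel_measurable M" "A \<in> sets M"
  shows "(\<integral>\<^sup>+x\<in>A. c * f x \<partial>M) = c * (\<integral>\<^sup>+x\<in>A. f x \<partial>M)"
  using assms by (simp add: nn_integral_cmult mult.assoc)

text \<open>The convex estimate on \<open>W\<close> is carried to the image: the bounds on
  \<open>J\<close> compare \<mu> with Lebesgue measure, and the Lipschitz bound turns short steps in
  \<open>W\<close> into short distances in the image.\<close>

lemma controlled_parametrized:
  fixes W :: "(real^'k) set" and f :: "real^'k \<Rightarrow> 'a::euclidean_space"
  assumes [measurable]: "W \<in> sets borel" "f ` W \<in> sets borel" "f \<in> borel_measurable borel" "J \<in> borel_measurable borel"
    and "convex W" and D: "0 < D" "\<And>x y. x \<in> W \<Longrightarrow> y \<in> W \<Longrightarrow> norm (x - y) \<le> D"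
    and L: "0 < L" "\<And>x y. x \<in> W \<Longrightarrow> y \<in> W \<Longrightarrow> norm (f x - f y) \<le> L * norm (x - y)"
    and a: "0 < a" "\<And>x. x \<in> W \<Longrightarrow> a \<le> J x" and b: "\<And>x. x \<in> W \<Longrightarrow> J x \<le> b"
    and int: "\<And>g. g \<in> borel_measurable borel \<Longrightarrow>
      (\<integral>\<^sup>+x\<in>f ` W. g x \<partial>\<mu>) = (\<integral>\<^sup>+x\<in>W. g (f x) * ennreal (J x) \<partial>lborel)"
    and [measurable_cong]: "sets \<mu> = sets borel" and "sigma_finite_measure \<mu>"
  shows "controlled CARD('k) \<mu> (f ` W) (f ` W)"
proof -
  interpret sigma_finite_measure \<mu> by fact
  define k where "k = CARD('k)"
  \<comment> \<open>\<open>b\<^sup>2\<close> bounds the two Jacobians from above,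
    \<open>1 / a\<^sup>2\<close> pays for reinserting them, \<open>(2 * D * L) ^ (k + 2)\<close>
    comes from the bound on \<open>n\<close>, and the last factor from
    \<open>inverse_sqrt_power_eq_C_t\<close>.\<close>
  define C where "C = b\<^sup>2 / a\<^sup>2 * (2 * D * L) ^ (k + 2) * ((2 * pi) powr (real k / 2) / 2)"
  have int2: "(\<integral>\<^sup>+x\<in>f ` W. \<integral>\<^sup>+y\<in>f ` W. K x y \<partial>\<mu> \<partial>\<mu>) =
      (\<integral>\<^sup>+x\<in>W. (\<integral>\<^sup>+y\<in>W. K (f x) (f y) * ennreal (J y) \<partial>lborel) * ennreal (J x) \<partial>lborel)"
    if [measurable]: "case_prod K \<in> borel_measurable (borel \<Otimes>\<^sub>M borel)" for K
    by (subst int) (auto simp: int)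
  have main: "sq_osc \<mu> u (f ` W) (f ` W) \<le> ennreal (C * C_t k t / t) * near_osc \<mu> t u"
    if t: "0 < t" "t < (D * L)\<^sup>2 / 2" and [measurable]: "u \<in> borel_measurable borel" for t u
  proof (cases "W = {}")
    case True
    then show ?thesis by (simp add: sq_osc_def)
  next
    case False
    then have "b \<ge> a" "b > 0" using a b by force+
    define s where "s = sqrt (2 * t)"
    \<comment> \<open>Least number of steps for which the images of consecutive points are within
      \<open>s\<close>. Since \<open>t\<close> is below \<open>(D * L)\<^sup>2 / 2\<close>, the
      quotient is at least 1 and rounding up at most doubles it.\<close>
    define n where "n = nat \<lceil>D * L / s\<rceil>"
    have s: "s > 0" "s\<^sup>2 = 2 * t" using t by (simp_all add: s_def)
    have "s \<le> D * L" using t D(1) L(1) unfolding s_def by (intro real_le_lsqrt) auto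
    then have q: "1 \<le> D * L / s" using s by (simp add: field_simps)
    then have n_ge: "real n \<ge> D * L / s" and "n > 0" and n_le: "real n \<le> 2 * (D * L / s)"
      unfolding n_def by linarith+
    have Dn: "L * (D / real n) \<le> s"
      using n_ge s \<open>n > 0\<close> by (simp add: field_simps)
    define v where "v x = u (f x)" for x
    have [measurable]: "v \<in> borel_measurable borel" unfolding v_def by measurable
    let ?d = "\<lambda>x y. ennreal ((v x - v y)\<^sup>2)"
    let ?e = "\<lambda>x y. ennreal ((u x - u y)\<^sup>2) * indicator {z. (norm (fst z - snd z))\<^sup>2 \<le> 2 * t} (x, y)"
    have "sq_osc \<mu> u (f ` W) (f ` W) =
        (\<integral>\<^sup>+x\<in>W. (\<integral>\<^sup>+y\<in>W. ?d x y * ennreal (J y) \<partial>lborel) * ennreal (J x) \<partial>lborel)"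
      unfolding sq_osc_def v_def by (rule int2) measurable
    also have "\<dots> \<le> (\<integral>\<^sup>+x\<in>W. (\<integral>\<^sup>+y\<in>W. ?d x y * ennreal b \<partial>lborel) * ennreal b \<partial>lborel)"
      using b by (intro nn_integral_set_mono mult_mono) (auto intro!: ennreal_leI)
    also have "\<dots> = ennreal (b\<^sup>2) * (\<integral>\<^sup>+x\<in>W. \<integral>\<^sup>+y\<in>W. ?d x y \<partial>lborel \<partial>lborel)"
    proof -
      have "ennreal (b\<^sup>2) = ennreal b * ennreal b"
        using \<open>b > 0\<close> by (simp add: power2_eq_square ennreal_mult)
      then show ?thesis
        by (simp add: nn_integral_multc nn_integral_cmult[symmetric] mult_ac)
    qed
    also have "\<dots> \<le> ennreal (b\<^sup>2) * (ennreal (real n ^ (DIM(real^'k) + 2)) *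
      (\<integral>\<^sup>+x\<in>W. \<integral>\<^sup>+y\<in>W. ?d x y * indicator {y. norm (x - y) \<le> D / real n} y \<partial>lborel \<partial>lborel))"
      by (intro mult_left_mono convex_nonlocal_poincare \<open>convex W\<close> \<open>n > 0\<close> D(2)) auto
    \<comment> \<open>Two enlargements at once: closeness of the parameters implies closeness of the
      images, and the product of the two Jacobians divided by \<open>a\<^sup>2\<close> is at least
      1.\<close>
    also have "\<dots> \<le> ennreal (b\<^sup>2) * (ennreal (real n ^ (DIM(real^'k) + 2)) *
      (\<integral>\<^sup>+x\<in>W. \<integral>\<^sup>+y\<in>W. ennreal (1 / a\<^sup>2) * (?e (f x) (f y) * ennreal (J y) * ennreal (J x)) \<partial>lborel \<partial>lborel))"
    proof (intro mult_left_mono nn_integral_set_mono)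
      fix x y assume xy: "x \<in> W" "y \<in> W"
      show "?d x y * indicator {y. norm (x - y) \<le> D / real n} y \<le>
          ennreal (1 / a\<^sup>2) * (?e (f x) (f y) * ennreal (J y) * ennreal (J x))"
      proof (cases "norm (x - y) \<le> D / real n")
        case True
        have "norm (f x - f y) \<le> L * norm (x - y)" by (rule L(2)[OF xy])
        also have "\<dots> \<le> L * (D / real n)" using True L(1) by (intro mult_left_mono) auto
        also have "\<dots> \<le> s" by (rule Dn)
        finally have near: "(norm (f x - f y))\<^sup>2 \<le> 2 * t"
          using s(2) power_mono[of "norm (f x - f y)" s 2] by simp
        have J: "a\<^sup>2 \<le> J y * J x" "0 \<le> J x" "0 \<le> J y"
          using a(1) a(2)[OF xy(1)] a(2)[OF xy(2)] mult_mono[of a "J y" a "J x"]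
          by (auto simp: power2_eq_square)
        then have "1 \<le> 1 / a\<^sup>2 * (J y * J x)" using a(1) by simp
        then have "1 * (v x - v y)\<^sup>2 \<le> (1 / a\<^sup>2 * (J y * J x)) * (v x - v y)\<^sup>2"
          by (rule mult_right_mono) simp
        then have "ennreal ((v x - v y)\<^sup>2) \<le> ennreal (1 / a\<^sup>2 * ((v x - v y)\<^sup>2 * J y * J x))"
          by (intro ennreal_leI) (simp add: mult_ac)
        also have "\<dots> = ennreal (1 / a\<^sup>2) * (?d x y * ennreal (J y) * ennreal (J x))"
          using J by (simp add: ennreal_mult del: times_divide_eq_left)
        finally show ?thesis using near True by (simp add: v_def)
      qed simp
    qed auto
    also have "(\<integral>\<^sup>+x\<in>W. \<integral>\<^sup>+y\<in>W. ennreal (1 / a\<^sup>2) * (?e (f x) (f y) * ennreal (J y) * ennreal (J x)) \<partial>lborel \<partial>lborel)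
       = ennreal (1 / a\<^sup>2) * (\<integral>\<^sup>+x\<in>W. (\<integral>\<^sup>+y\<in>W. ?e (f x) (f y) * ennreal (J y) \<partial>lborel) * ennreal (J x) \<partial>lborel)"
      by (subst nn_integral_set_cmult[symmetric])
        (auto simp: nn_integral_set_cmult mult_ac nn_integral_cmult[symmetric] intro!: nn_integral_cong)
    also have "(\<integral>\<^sup>+x\<in>W. (\<integral>\<^sup>+y\<in>W. ?e (f x) (f y) * ennreal (J y) \<partial>lborel) * ennreal (J x) \<partial>lborel)
       = (\<integral>\<^sup>+x\<in>f ` W. \<integral>\<^sup>+y\<in>f ` W. ?e x y \<partial>\<mu> \<partial>\<mu>)"
      by (rule int2[symmetric]) measurable
    also have "\<dots> \<le> near_osc \<mu> t u"
      unfolding near_osc_def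
      by (intro nn_integral_mono) (auto simp: indicator_def intro!: nn_integral_mono)
    finally have "sq_osc \<mu> u (f ` W) (f ` W) \<le>
        ennreal (b\<^sup>2) * (ennreal (real n ^ (k + 2)) * (ennreal (1 / a\<^sup>2) * near_osc \<mu> t u))"
      by (simp add: k_def mult_left_mono)
    also have "\<dots> = ennreal (b\<^sup>2 / a\<^sup>2 * real n ^ (k + 2)) * near_osc \<mu> t u"
    proof -
      have "b\<^sup>2 / a\<^sup>2 * real n ^ (k + 2) = b\<^sup>2 * (real n ^ (k + 2) * (1 / a\<^sup>2))" by simp
      then show ?thesis by (simp only: ennreal_mult zero_le_power2 zero_le_power of_nat_0_le_iff
            mult_nonneg_nonneg zero_le_divide_1_iff mult.assoc)
    qed
    also have "\<dots> \<le> ennreal (C * C_t k t / t) * near_osc \<mu> t u"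
    proof (intro mult_right_mono ennreal_leI)
      have "real n ^ (k + 2) \<le> ((2 * D * L) * (1 / s)) ^ (k + 2)"
        using n_le by (intro power_mono) auto
      also have "\<dots> = (2 * D * L) ^ (k + 2) * ((2 * pi) powr (real k / 2) / 2 * C_t k t / t)"
        unfolding power_mult_distrib s_def inverse_sqrt_power_eq_C_t[OF t(1)] ..
      finally have "b\<^sup>2 / a\<^sup>2 * real n ^ (k + 2) \<le>
          b\<^sup>2 / a\<^sup>2 * ((2 * D * L) ^ (k + 2) * ((2 * pi) powr (real k / 2) / 2 * C_t k t / t))"
        by (intro mult_left_mono) auto
      then show "b\<^sup>2 / a\<^sup>2 * real n ^ (k + 2) \<le> C * C_t k t / t"
        by (simp add: C_def mult_ac)
    qed simp
    finally show ?thesis .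
  qed
  have "C \<ge> 0" using D(1) L(1) by (simp add: C_def)
  moreover have "(D * L)\<^sup>2 / 2 > 0" using D(1) L(1) by simp
  ultimately show ?thesis
    unfolding controlled_def k_def[symmetric] using main by blast
qed

subsection \<open>Chaining patches\<close>

lemma controlled_mono:
  assumes "controlled k \<mu> A B" "A' \<subseteq> A" "B' \<subseteq> B"
  shows "controlled k \<mu> A' B'"
proof -
  have "sq_osc \<mu> u A' B' \<le> sq_osc \<mu> u A B" for u
    unfolding sq_osc_def using assms(2,3)
    by (intro nn_integral_mono mult_mono) (auto simp: indicator_def intro!: nn_integral_mono)
  then show ?thesis
    using assms(1) unfolding controlled_def by (meson order_trans)
qed

lemma controlledI_lincomb:
  assumes A: "controlled k \<mu> A A'" and B: "controlled k \<mu> B B'" and "p \<ge> 0" "q \<ge> 0"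
    and le: "\<And>u. u \<in> borel_measurable borel \<Longrightarrow>
      sq_osc \<mu> u E E' \<le> ennreal p * sq_osc \<mu> u A A' + ennreal q * sq_osc \<mu> u B B'"
  shows "controlled k \<mu> E E'"
proof -
  obtain C1 t1 where 1: "C1 \<ge> 0" "t1 > 0"
    "\<And>t u. 0 < t \<Longrightarrow> t < t1 \<Longrightarrow> u \<in> borel_measurable borel \<Longrightarrow>
      sq_osc \<mu> u A A' \<le> ennreal (C1 * C_t k t / t) * near_osc \<mu> t u"
    using A unfolding controlled_def by blast
  obtain C2 t2 where 2: "C2 \<ge> 0" "t2 > 0"
    "\<And>t u. 0 < t \<Longrightarrow> t < t2 \<Longrightarrow> u \<in> borel_measurable borel \<Longrightarrow>
      sq_osc \<mu> u B B' \<le> ennreal (C2 * C_t k t / t) * near_osc \<mu> t u"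
    using B unfolding controlled_def by blast
  have "sq_osc \<mu> u E E' \<le> ennreal ((p * C1 + q * C2) * C_t k t / t) * near_osc \<mu> t u"
    if t: "0 < t" "t < min t1 t2" and u: "u \<in> borel_measurable borel" for t u
  proof -
    have "sq_osc \<mu> u E E' \<le> ennreal p * sq_osc \<mu> u A A' + ennreal q * sq_osc \<mu> u B B'"
      by (rule le[OF u])
    also have "\<dots> \<le> ennreal p * (ennreal (C1 * C_t k t / t) * near_osc \<mu> t u) +
        ennreal q * (ennreal (C2 * C_t k t / t) * near_osc \<mu> t u)"
      using t u by (intro add_mono mult_left_mono 1(3) 2(3)) auto
    also have "\<dots> = ennreal (p * (C1 * C_t k t / t) + q * (C2 * C_t k t / t)) * near_osc \<mu> t u"
      using 1(1) 2(1) t C_t_pos[of t k] \<open>p \<ge> 0\<close> \<open>q \<ge> 0\<close>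
      by (simp add: ennreal_mult ennreal_plus distrib_right mult.assoc del: times_divide_eq_left times_divide_eq_right)
    also have "p * (C1 * C_t k t / t) + q * (C2 * C_t k t / t) = (p * C1 + q * C2) * C_t k t / t"
      using t by (simp add: field_simps)
    finally show ?thesis .
  qed
  moreover have "p * C1 + q * C2 \<ge> 0" "min t1 t2 > 0" using assms(3,4) 1(1,2) 2(1,2) by auto
  ultimately show ?thesis unfolding controlled_def by blast
qed

context
  fixes \<mu> :: "'a::euclidean_space measure" and k :: nat
  assumes sets_\<mu> [measurable_cong]: "sets \<mu> = sets borel" and fin: "finite_measure \<mu>"
begin

interpretation finite_measure \<mu> by (fact fin)
interpretation P: pair_sigma_finite \<mu> \<mu> ..

lemma sq_osc_commute:
  assumes [measurable]: "A \<in> sets borel" "B \<in> sets borel" "u \<in> borel_measurable borel"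
  shows "sq_osc \<mu> u A B = sq_osc \<mu> u B A"
proof -
  have "sq_osc \<mu> u A B = (\<integral>\<^sup>+x. \<integral>\<^sup>+y. ennreal ((u x - u y)\<^sup>2) * indicator B y * indicator A x \<partial>\<mu> \<partial>\<mu>)"
    unfolding sq_osc_def by (intro nn_integral_cong nn_integral_multc[symmetric]) measurable
  also have "\<dots> = (\<integral>\<^sup>+y. \<integral>\<^sup>+x. ennreal ((u x - u y)\<^sup>2) * indicator B y * indicator A x \<partial>\<mu> \<partial>\<mu>)"
    by (rule P.Fubini'[symmetric]) measurable
  also have "\<dots> = (\<integral>\<^sup>+y. \<integral>\<^sup>+x. ennreal ((u y - u x)\<^sup>2) * indicator A x * indicator B y \<partial>\<mu> \<partial>\<mu>)"
    by (simp add: power2_commute mult_ac)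
  also have "\<dots> = sq_osc \<mu> u B A"
    unfolding sq_osc_def by (intro nn_integral_cong nn_integral_multc) measurable
  finally show ?thesis .
qed

lemma controlled_commute:
  assumes "controlled k \<mu> A B" "A \<in> sets borel" "B \<in> sets borel"
  shows "controlled k \<mu> B A"
  using assms unfolding controlled_def by (simp add: sq_osc_commute[of B A])

text \<open>Average \<open>(u x - u y)\<^sup>2 \<le> 2 (u x - u z)\<^sup>2 + 2 (u z - u y)\<^sup>2\<close> over \<open>z \<in> B\<close>.\<close>
lemma controlled_trans:
  assumes A: "controlled k \<mu> A B" and B: "controlled k \<mu> B E" and pos: "measure \<mu> B > 0"
    and [measurable]: "A \<in> sets borel" "B \<in> sets borel" "E \<in> sets borel"
  shows "controlled k \<mu> A E"
proof (rule controlledI_lincomb[OF A B])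
  let ?m = "measure \<mu>"
  show "2 * ?m E / ?m B \<ge> 0" "2 * ?m A / ?m B \<ge> 0" by auto
  fix u :: "'a \<Rightarrow> real" assume [measurable]: "u \<in> borel_measurable borel"
  let ?d = "\<lambda>x y. ennreal ((u x - u y)\<^sup>2)"
  \<comment> \<open>The factor is written as an integral over a dummy variable \<open>z\<close> in
    \<open>B\<close>, which then serves as intermediate point.\<close>
  have "ennreal (?m B) * sq_osc \<mu> u A E = (\<integral>\<^sup>+x\<in>A. \<integral>\<^sup>+y\<in>E. \<integral>\<^sup>+z\<in>B. ?d x y \<partial>\<mu> \<partial>\<mu> \<partial>\<mu>)"
    unfolding sq_osc_def
    by (simp add: nn_integral_cmult_indicator emeasure_eq_measure nn_integral_cmult[symmetric]
        nn_integral_multc mult_ac sets_\<mu>)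
  also have "\<dots> \<le> (\<integral>\<^sup>+x\<in>A. \<integral>\<^sup>+y\<in>E. \<integral>\<^sup>+z\<in>B. 2 * ?d x z + 2 * ?d z y \<partial>\<mu> \<partial>\<mu> \<partial>\<mu>)"
  proof (intro nn_integral_set_mono)
    fix x y z
    \<comment> \<open>This square is the difference of the two sides of the inequality
      sought.\<close>
    have "0 \<le> (u x - u z - (u z - u y))\<^sup>2" by simp
    then have "(u x - u y)\<^sup>2 \<le> 2 * (u x - u z)\<^sup>2 + 2 * (u z - u y)\<^sup>2"
      by (simp add: power2_eq_square algebra_simps)
    then have "?d x y \<le> ennreal (2 * (u x - u z)\<^sup>2 + 2 * (u z - u y)\<^sup>2)"
      by (rule ennreal_leI)
    then show "?d x y \<le> 2 * ?d x z + 2 * ?d z y"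
      by (simp add: ennreal_plus ennreal_mult)
  qed
  also have "\<dots> = (\<integral>\<^sup>+x\<in>A. \<integral>\<^sup>+y\<in>E. (\<integral>\<^sup>+z\<in>B. 2 * ?d x z \<partial>\<mu>) + (\<integral>\<^sup>+z\<in>B. 2 * ?d z y \<partial>\<mu>) \<partial>\<mu> \<partial>\<mu>)"
    by (simp add: distrib_right nn_integral_add)
  also have "\<dots> = (\<integral>\<^sup>+x\<in>A. (\<integral>\<^sup>+y\<in>E. (\<integral>\<^sup>+z\<in>B. 2 * ?d x z \<partial>\<mu>) \<partial>\<mu>) + (\<integral>\<^sup>+y\<in>E. (\<integral>\<^sup>+z\<in>B. 2 * ?d z y \<partial>\<mu>) \<partial>\<mu>) \<partial>\<mu>)"
    by (simp add: distrib_right nn_integral_add)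
  also have "\<dots> = (\<integral>\<^sup>+x\<in>A. (\<integral>\<^sup>+y\<in>E. (\<integral>\<^sup>+z\<in>B. 2 * ?d x z \<partial>\<mu>) \<partial>\<mu>) \<partial>\<mu>) +
      (\<integral>\<^sup>+x\<in>A. (\<integral>\<^sup>+y\<in>E. (\<integral>\<^sup>+z\<in>B. 2 * ?d z y \<partial>\<mu>) \<partial>\<mu>) \<partial>\<mu>)"
    by (simp add: distrib_right nn_integral_add)
  also have "(\<integral>\<^sup>+x\<in>A. (\<integral>\<^sup>+y\<in>E. (\<integral>\<^sup>+z\<in>B. 2 * ?d x z \<partial>\<mu>) \<partial>\<mu>) \<partial>\<mu>) = ennreal (2 * ?m E) * sq_osc \<mu> u A B"
  proof -
    have B: "(\<integral>\<^sup>+z\<in>B. 2 * ?d x z \<partial>\<mu>) = 2 * (\<integral>\<^sup>+z\<in>B. ?d x z \<partial>\<mu>)" for x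
      by (rule nn_integral_set_cmult) measurable
    have E: "(\<integral>\<^sup>+y\<in>E. (\<integral>\<^sup>+z\<in>B. 2 * ?d x z \<partial>\<mu>) \<partial>\<mu>) = ennreal (2 * ?m E) * (\<integral>\<^sup>+z\<in>B. ?d x z \<partial>\<mu>)" for x
      by (subst B, subst nn_integral_cmult_indicator)
        (simp_all add: emeasure_eq_measure sets_\<mu> ennreal_mult mult_ac)
    show ?thesis unfolding sq_osc_def E by (rule nn_integral_set_cmult) measurable
  qed
  also have "(\<integral>\<^sup>+x\<in>A. (\<integral>\<^sup>+y\<in>E. (\<integral>\<^sup>+z\<in>B. 2 * ?d z y \<partial>\<mu>) \<partial>\<mu>) \<partial>\<mu>) = ennreal (2 * ?m A) * sq_osc \<mu> u E B"
  proof -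
    have d: "?d z y = ?d y z" for y z by (simp only: power2_commute[of "u z" "u y"])
    have B: "(\<integral>\<^sup>+z\<in>B. 2 * ?d z y \<partial>\<mu>) = 2 * (\<integral>\<^sup>+z\<in>B. ?d y z \<partial>\<mu>)" for y
      by (subst d, rule nn_integral_set_cmult) measurable
    have E: "(\<integral>\<^sup>+y\<in>E. (\<integral>\<^sup>+z\<in>B. 2 * ?d z y \<partial>\<mu>) \<partial>\<mu>) = 2 * sq_osc \<mu> u E B"
      unfolding sq_osc_def B by (rule nn_integral_set_cmult) measurable
    show ?thesis
      by (subst E, subst nn_integral_cmult_indicator)
        (simp_all add: emeasure_eq_measure sets_\<mu> ennreal_mult mult_ac)
  qed
  also have "sq_osc \<mu> u E B = sq_osc \<mu> u B E" by (rule sq_osc_commute) measurable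
  finally have le: "ennreal (?m B) * sq_osc \<mu> u A E \<le>
      ennreal (2 * ?m E) * sq_osc \<mu> u A B + ennreal (2 * ?m A) * sq_osc \<mu> u B E" .
  have "sq_osc \<mu> u A E = ennreal (1 / ?m B) * (ennreal (?m B) * sq_osc \<mu> u A E)"
    using pos by (simp add: mult.assoc[symmetric] ennreal_mult[symmetric])
  also have "\<dots> \<le> ennreal (1 / ?m B) * (ennreal (2 * ?m E) * sq_osc \<mu> u A B + ennreal (2 * ?m A) * sq_osc \<mu> u B E)"
    by (intro mult_left_mono le) simp
  also have "\<dots> = ennreal (2 * ?m E / ?m B) * sq_osc \<mu> u A B + ennreal (2 * ?m A / ?m B) * sq_osc \<mu> u B E"
    using pos by (simp add: distrib_left mult.assoc[symmetric] ennreal_mult[symmetric])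
  finally show "sq_osc \<mu> u A E \<le> ennreal (2 * ?m E / ?m B) * sq_osc \<mu> u A B + ennreal (2 * ?m A / ?m B) * sq_osc \<mu> u B E" .
qed

lemma controlled_Un_left:
  assumes "controlled k \<mu> A B" "controlled k \<mu> A' B"
    and [measurable]: "A \<in> sets borel" "A' \<in> sets borel" "B \<in> sets borel"
  shows "controlled k \<mu> (A \<union> A') B"
proof (rule controlledI_lincomb[OF assms(1,2), of 1 1])
  fix u :: "'a \<Rightarrow> real" assume [measurable]: "u \<in> borel_measurable borel"
  have "sq_osc \<mu> u (A \<union> A') B \<le>
    (\<integral>\<^sup>+x. (\<integral>\<^sup>+y\<in>B. ennreal ((u x - u y)\<^sup>2) \<partial>\<mu>) * indicator A x + (\<integral>\<^sup>+y\<in>B. ennreal ((u x - u y)\<^sup>2) \<partial>\<mu>) * indicator A' x \<partial>\<mu>)"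
    unfolding sq_osc_def by (intro nn_integral_mono) (auto simp: indicator_def)
  also have "\<dots> = sq_osc \<mu> u A B + sq_osc \<mu> u A' B"
    unfolding sq_osc_def by (intro nn_integral_add) measurable
  finally show "sq_osc \<mu> u (A \<union> A') B \<le> ennreal 1 * sq_osc \<mu> u A B + ennreal 1 * sq_osc \<mu> u A' B"
    by simp
qed auto

lemma controlled_UN_left:
  assumes "finite I" "\<And>i. i \<in> I \<Longrightarrow> controlled k \<mu> (A i) B" "\<And>i. i \<in> I \<Longrightarrow> A i \<in> sets borel" "B \<in> sets borel"
  shows "controlled k \<mu> (\<Union>i\<in>I. A i) B"
  using assms
proof (induction I)
  case empty
  show ?case by (auto simp: controlled_def sq_osc_def intro: exI[of _ 1])
next
  case (insert i I)
  then show ?case by (auto intro!: controlled_Un_left)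
qed

text \<open>Chaining overlapping patches shows that any two points of a connected set have controlled
  neighbourhoods; compactness then leaves finitely many pairs of patches.\<close>
lemma controlled_compact_connected:
  assumes "compact M" "connected M"
    and pos: "\<And>A. openin (top_of_set M) A \<Longrightarrow> A \<noteq> {} \<Longrightarrow> 0 < measure \<mu> A"
    and loc: "\<And>x. x \<in> M \<Longrightarrow> \<exists>Q. openin (top_of_set M) Q \<and> x \<in> Q \<and> controlled k \<mu> Q Q"
  shows "controlled k \<mu> M M"
proof -
  have borel: "A \<in> sets borel" if "openin (top_of_set M) A" for A
    using that \<open>compact M\<close> by (auto simp: openin_open intro: borel_compact)
  \<comment> \<open>An equivalence relation whose classes are relatively open, so there is only one
    class on a connected set.\<close>
  define R where "R x y \<longleftrightarrow> (\<exists>A B. openin (top_of_set M) A \<and> openin (top_of_set M) B \<and> x \<in> A \<and> y \<in> B \<and>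
    controlled k \<mu> A B)" for x y
  have R: "R x y" if "x \<in> M" "y \<in> M" for x y
  proof (rule connected_equivalence_relation[OF \<open>connected M\<close> that])
    show "R y x" if "R x y" for x y
      using that controlled_commute borel unfolding R_def by meson
    show "\<exists>T. openin (top_of_set M) T \<and> a \<in> T \<and> (\<forall>x\<in>T. R a x)" if "a \<in> M" for a
      using loc[OF that] unfolding R_def by blast
    fix x y z assume "R x y" "R y z"
    then obtain A B B' E where o: "openin (top_of_set M) A" "openin (top_of_set M) B"
      "openin (top_of_set M) B'" "openin (top_of_set M) E" and "x \<in> A" "y \<in> B" "y \<in> B'" "z \<in> E"
      and "controlled k \<mu> A B" "controlled k \<mu> B' E"
      unfolding R_def by blast
    \<comment> \<open>The two neighbourhoods of \<open>y\<close> need not agree. Their intersection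
      is relatively open and contains \<open>y\<close>, hence has the positive measure required for
      averaging over it.\<close>
    have "openin (top_of_set M) (B \<inter> B')" using o by (simp add: openin_Int)
    moreover have "controlled k \<mu> A (B \<inter> B')" "controlled k \<mu> (B \<inter> B') E"
      using \<open>controlled k \<mu> A B\<close> \<open>controlled k \<mu> B' E\<close> by (auto elim: controlled_mono)
    ultimately have "controlled k \<mu> A E"
      using pos[of "B \<inter> B'"] \<open>y \<in> B\<close> \<open>y \<in> B'\<close> o by (intro controlled_trans[of A "B \<inter> B'" E]) (auto intro: borel)
    then show "R x z" using o \<open>x \<in> A\<close> \<open>z \<in> E\<close> unfolding R_def by blast
  qed
  obtain Q where Q: "\<And>x. x \<in> M \<Longrightarrow> openin (top_of_set M) (Q x) \<and> x \<in> Q x \<and> controlled k \<mu> (Q x) (Q x)"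
    using loc by metis
  \<comment> \<open>The neighbourhoods given by \<open>R\<close> depend on the pair of points.
    Passing through \<open>Q x \<inter> A\<close> and \<open>Q y \<inter> B\<close> replaces them by
    patches fixed in advance, from which one finite cover can be chosen.\<close>
  have QQ: "controlled k \<mu> (Q x) (Q y)" if x: "x \<in> M" and y: "y \<in> M" for x y
  proof -
    obtain A B where AB: "openin (top_of_set M) A" "openin (top_of_set M) B" "x \<in> A" "y \<in> B" "controlled k \<mu> A B"
      using R[OF x y] unfolding R_def by blast
    let ?A = "Q x \<inter> A" and ?B = "Q y \<inter> B"
    have o: "openin (top_of_set M) ?A" "openin (top_of_set M) ?B" "openin (top_of_set M) (Q x)" "openin (top_of_set M) (Q y)"
      using AB Q[OF x] Q[OF y] by (simp_all add: openin_Int)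
    have p: "measure \<mu> ?A > 0" "measure \<mu> ?B > 0"
      using pos[OF o(1)] pos[OF o(2)] AB Q[OF x] Q[OF y] by auto
    have "controlled k \<mu> (Q x) ?A" "controlled k \<mu> ?A ?B" "controlled k \<mu> ?B (Q y)"
      using Q[OF x] Q[OF y] AB(5) by (auto elim: controlled_mono)
    then show ?thesis
      using o[THEN borel] p controlled_trans by meson
  qed
  have "\<forall>x\<in>M. \<exists>T. open T \<and> Q x = M \<inter> T" using Q by (auto simp: openin_open)
  then obtain T where T: "\<And>x. x \<in> M \<Longrightarrow> open (T x)" "\<And>x. x \<in> M \<Longrightarrow> Q x = M \<inter> T x" by metis
  have "M \<subseteq> (\<Union>x\<in>M. T x)" using T(2) Q by auto
  then obtain I where "I \<subseteq> M" "finite I" "M \<subseteq> (\<Union>x\<in>I. T x)"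
    using compactE_image[OF \<open>compact M\<close>, of M T] T(1) by metis
  moreover have "Q x = M \<inter> T x" if "x \<in> I" for x using T(2) that \<open>I \<subseteq> M\<close> by auto
  ultimately have I: "I \<subseteq> M" "finite I" "M \<subseteq> (\<Union>x\<in>I. Q x)" by (simp, simp, fastforce)
  have "\<Union> (Q ` I) \<in> sets borel" 
    using I Q borel by (intro sets.finite_UN) auto
  then have "controlled k \<mu> (Q x) (\<Union>y\<in>I. Q y)" if "x \<in> I" for x
    using I(2) Q QQ borel \<open>\<Union> (Q ` I) \<in> sets borel\<close> that subsetD[OF I(1)]
    by (intro controlled_commute[OF controlled_UN_left]) auto
  then have "controlled k \<mu> (\<Union>x\<in>I. Q x) (\<Union>y\<in>I. Q y)"
    using I Q borel \<open>\<Union> (Q ` I) \<in> sets borel\<close> by (intro controlled_UN_left) auto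
  then show ?thesis using I(3) by (auto elim: controlled_mono)
qed

end

subsection \<open>The Dirichlet form\<close>

text \<open>The lower Jacobian bound gives positive mass and the upper one finite mass. Smallness of
  the patch yields positivity for every nonempty relatively open set; finiteness leads to finiteness
  of \<mu>.\<close>

lemma volume_measure_patch:
  fixes M :: "(real^'d) set" and \<mu> :: "(real^'d) measure"
  assumes "smooth_submanifold_with_boundary TYPE('k::finite) M" "M \<in> sets borel"
    and vol: "is_volume_measure TYPE('k) M \<mu>"
    and p: "p \<in> M" "p \<in> T" "open T"
  obtains Q where "openin (top_of_set M) Q" "p \<in> Q" "Q \<subseteq> T" "0 < emeasure \<mu> Q" "emeasure \<mu> Q < \<infinity>"
proof -
  obtain W :: "(real^'k) set" and f and J and D L a b where
    W [measurable]: "W \<in> sets borel" "0 < emeasure lborel W" "emeasure lborel W < \<infinity>"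
    and Q: "p \<in> f ` W" "f ` W \<subseteq> T" "openin (top_of_set M) (f ` W)" "f ` W \<in> sets borel"
    and a: "0 < a" "\<And>x. x \<in> W \<Longrightarrow> a \<le> J x" and b: "\<And>x. x \<in> W \<Longrightarrow> J x \<le> b"
    and int: "\<And>g. g \<in> borel_measurable borel \<Longrightarrow>
      (\<integral>\<^sup>+x\<in>f ` W. g x \<partial>\<mu>) = (\<integral>\<^sup>+x\<in>W. g (f x) * ennreal (J x) \<partial>lborel)"
    by (rule local_parametrization[OF assms]) blast
  have "emeasure \<mu> (f ` W) = (\<integral>\<^sup>+x\<in>W. ennreal (J x) \<partial>lborel)"
    using int[of "\<lambda>_. 1"] Q(4) vol by (simp add: is_volume_measure_def)
  moreover have "ennreal a * emeasure lborel W \<le> (\<integral>\<^sup>+x\<in>W. ennreal (J x) \<partial>lborel)"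
    "(\<integral>\<^sup>+x\<in>W. ennreal (J x) \<partial>lborel) \<le> ennreal b * emeasure lborel W"
    using a b nn_integral_set_mono[of W "\<lambda>_. ennreal a" "\<lambda>x. ennreal (J x)" lborel]
      nn_integral_set_mono[of W "\<lambda>x. ennreal (J x)" "\<lambda>_. ennreal b" lborel]
    by (auto simp: nn_integral_cmult_indicator intro: ennreal_leI)
  moreover have "0 < ennreal a * emeasure lborel W" "ennreal b * emeasure lborel W < \<infinity>"
    using W a(1) by (auto simp: ennreal_zero_less_mult_iff ennreal_mult_less_top)
  ultimately show thesis using that[of "f ` W"] Q by (metis order_less_le_trans order_le_less_trans)
qed

lemma volume_measure_controlled_patch:
  fixes M :: "(real^'d) set" and \<mu> :: "(real^'d) measure"
  assumes "smooth_submanifold_with_boundary TYPE('k::finite) M" "M \<in> sets borel"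
    and vol: "is_volume_measure TYPE('k) M \<mu>" and "finite_measure \<mu>" "p \<in> M"
  shows "\<exists>Q. openin (top_of_set M) Q \<and> p \<in> Q \<and> controlled CARD('k) \<mu> Q Q"
proof -
  interpret finite_measure \<mu> by fact
  have sets: "sets \<mu> = sets borel" using vol by (simp add: is_volume_measure_def)
  obtain W :: "(real^'k) set" and f and J and D L a b where
    1: "convex W" "W \<in> sets borel" "0 < D" "\<And>x y. x \<in> W \<Longrightarrow> y \<in> W \<Longrightarrow> norm (x - y) \<le> D"
    and 2: "p \<in> f ` W" "openin (top_of_set M) (f ` W)" "f ` W \<in> sets borel"
    "f \<in> borel_measurable borel" "J \<in> borel_measurable borel"
    "0 < L" "\<And>x y. x \<in> W \<Longrightarrow> y \<in> W \<Longrightarrow> norm (f x - f y) \<le> L * norm (x - y)"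
    "0 < a" "\<And>x. x \<in> W \<Longrightarrow> a \<le> J x" "\<And>x. x \<in> W \<Longrightarrow> J x \<le> b"
    "\<And>g. g \<in> borel_measurable borel \<Longrightarrow>
      (\<integral>\<^sup>+x\<in>f ` W. g x \<partial>\<mu>) = (\<integral>\<^sup>+x\<in>W. g (f x) * ennreal (J x) \<partial>lborel)"
    by (rule local_parametrization[OF assms(1,2) vol \<open>p \<in> M\<close> UNIV_I open_UNIV]) blast
  have "controlled CARD('k) \<mu> (f ` W) (f ` W)"
    by (rule controlled_parametrized[OF 1(2) 2(3,4,5) 1(1,3,4) 2(6-11) sets sigma_finite_measure_axioms])
  then show ?thesis using 2(1,2) by blast
qed

text \<open>Finitely many patches of finite mass cover the compact set, and its complement is null.
  Fubini and the averaging argument rest on this.\<close>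

lemma finite_measure_volume_measure:
  fixes M :: "(real^'d) set" and \<mu> :: "(real^'d) measure"
  assumes "smooth_submanifold_with_boundary TYPE('k::finite) M" "compact M"
    and vol: "is_volume_measure TYPE('k) M \<mu>"
  shows "finite_measure \<mu>"
proof -
  have M: "M \<in> sets borel" using \<open>compact M\<close> by (rule borel_compact)
  have sets: "sets \<mu> = sets borel" and null: "emeasure \<mu> (- M) = 0"
    using vol by (auto simp: is_volume_measure_def)
  have "\<exists>T. open T \<and> x \<in> T \<and> emeasure \<mu> (M \<inter> T) < \<infinity>" if x: "x \<in> M" for x
    by (rule volume_measure_patch[OF assms(1) M vol x UNIV_I open_UNIV]) (auto simp: openin_open)
  then obtain T where T: "\<And>x. x \<in> M \<Longrightarrow> open (T x)" "\<And>x. x \<in> M \<Longrightarrow> x \<in> T x"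
    "\<And>x. x \<in> M \<Longrightarrow> emeasure \<mu> (M \<inter> T x) < \<infinity>" by metis
  have "M \<subseteq> (\<Union>x\<in>M. T x)" using T(2) by auto
  then obtain I where I: "I \<subseteq> M" "finite I" "M \<subseteq> (\<Union>x\<in>I. T x)"
    using compactE_image[OF \<open>compact M\<close>, of M T] T(1) by metis
  have m: "M \<inter> T x \<in> sets \<mu>" if "x \<in> I" for x
    using that I T(1) M sets by auto
  have "emeasure \<mu> (\<Union>x\<in>I. M \<inter> T x) \<le> (\<Sum>x\<in>I. emeasure \<mu> (M \<inter> T x))"
    using I(2) m by (intro emeasure_subadditive_finite) auto
  also have "\<dots> < \<infinity>" using I T(3) by (auto simp: subset_iff)
  also have "(\<Union>x\<in>I. M \<inter> T x) = M" using I by auto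
  finally have "emeasure \<mu> M < \<infinity>" .
  moreover have "emeasure \<mu> UNIV \<le> emeasure \<mu> M + emeasure \<mu> (- M)"
    using emeasure_subadditive[of M \<mu> "- M"] M sets by simp
  moreover have "space \<mu> = UNIV" using sets_eq_imp_space_eq[OF sets] by simp
  ultimately show ?thesis using null by (intro finite_measureI) auto
qed

text \<open>Symmetrization: exchanging \<open>x\<close> and \<open>y\<close> and adding produces the
  square. It serves twice, for the kernel \<open>R_t\<close> and for the constant kernel 1, which
  gives the variance.\<close>

lemma dirichlet_form_identity:
  fixes u :: "'a \<Rightarrow> real" and K :: "'a \<Rightarrow> 'a \<Rightarrow> real"
  assumes "finite_measure M" and [measurable]: "u \<in> borel_measurable M" and u2: "integrable M (\<lambda>x. (u x)\<^sup>2)"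
    and [measurable]: "case_prod K \<in> borel_measurable (M \<Otimes>\<^sub>M M)"
    and K: "\<And>x y. K x y = K y x" "\<And>x y. 0 \<le> K x y" "\<And>x y. K x y \<le> c"
  shows "ennreal (2 * (\<integral>x. u x * (\<integral>y. K x y * (u x - u y) \<partial>M) \<partial>M)) =
      (\<integral>\<^sup>+x. \<integral>\<^sup>+y. ennreal (K x y * (u x - u y)\<^sup>2) \<partial>M \<partial>M)"
    and "0 \<le> (\<integral>x. u x * (\<integral>y. K x y * (u x - u y) \<partial>M) \<partial>M)"
proof -
  interpret finite_measure M by fact
  interpret P: pair_sigma_finite M M ..
  have c: "c \<ge> 0" using K(2,3) order_trans by blast
  have i1: "integrable (M \<Otimes>\<^sub>M M) (\<lambda>(x, y). (u x)\<^sup>2)"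
    using u2 by (intro P.Fubini_integrable) auto
  have i2: "integrable (M \<Otimes>\<^sub>M M) (\<lambda>(x, y). (u y)\<^sup>2)"
    using P.integrable_product_swap[OF i1] by simp
  define h where "h = (\<lambda>(x, y). K x y * (u x - u y) * u x)"
  have [measurable]: "h \<in> borel_measurable (M \<Otimes>\<^sub>M M)" unfolding h_def by measurable
  have h: "integrable (M \<Otimes>\<^sub>M M) h"
  proof (rule Bochner_Integration.integrable_bound)
    show "integrable (M \<Otimes>\<^sub>M M) (\<lambda>z. 2 * c * ((case z of (x, y) \<Rightarrow> (u x)\<^sup>2) + (case z of (x, y) \<Rightarrow> (u y)\<^sup>2)))"
      using i1 i2 by (intro integrable_mult_right Bochner_Integration.integrable_add)
    \<comment> \<open>This majorant is integrable because the measure is finite; it justifies Fubini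
      and the exchange of variables for a signed integrand.\<close>
    have "norm (h (x, y)) \<le> 2 * c * ((u x)\<^sup>2 + (u y)\<^sup>2)" for x y
    proof -
      have "0 \<le> (\<bar>u x\<bar> - \<bar>u y\<bar>)\<^sup>2" by simp
      then have "2 * \<bar>u x * u y\<bar> \<le> (u x)\<^sup>2 + (u y)\<^sup>2"
        by (simp add: power2_diff abs_mult)
      moreover have "\<bar>(u x - u y) * u x\<bar> \<le> (u x)\<^sup>2 + \<bar>u x * u y\<bar>"
        using abs_triangle_ineq4[of "u x * u x" "u x * u y"] by (simp add: algebra_simps power2_eq_square)
      ultimately have "\<bar>(u x - u y) * u x\<bar> \<le> 2 * ((u x)\<^sup>2 + (u y)\<^sup>2)"
        using zero_le_power2[of "u y"] zero_le_power2[of "u x"]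
        unfolding distrib_left by linarith
      then have "K x y * \<bar>(u x - u y) * u x\<bar> \<le> c * (2 * ((u x)\<^sup>2 + (u y)\<^sup>2))"
        using K c by (intro mult_mono) auto
      then show ?thesis using K(2)[of x y] by (simp add: h_def abs_mult mult_ac)
    qed
    then show "AE z in M \<Otimes>\<^sub>M M. norm (h z) \<le>
        norm (2 * c * ((case z of (x, y) \<Rightarrow> (u x)\<^sup>2) + (case z of (x, y) \<Rightarrow> (u y)\<^sup>2)))"
      using c by (intro AE_I2) (auto split: prod.splits)
  qed measurable
  have h': "integrable (M \<Otimes>\<^sub>M M) (\<lambda>(x, y). h (y, x))"
    using P.integrable_product_swap[OF h] .
  have sum: "h (x, y) + h (y, x) = K x y * (u x - u y)\<^sup>2" for x y
    unfolding h_def using K(1)[of y x] by (simp add: power2_eq_square algebra_simps)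
  have "(\<integral>x. u x * (\<integral>y. K x y * (u x - u y) \<partial>M) \<partial>M) = (\<integral>x. \<integral>y. h (x, y) \<partial>M \<partial>M)"
    unfolding h_def by (simp add: mult.commute)
  also have "\<dots> = integral\<^sup>L (M \<Otimes>\<^sub>M M) h"
    using P.integral_fst'[of h] h by simp
  finally have "2 * (\<integral>x. u x * (\<integral>y. K x y * (u x - u y) \<partial>M) \<partial>M) =
      integral\<^sup>L (M \<Otimes>\<^sub>M M) h + integral\<^sup>L (M \<Otimes>\<^sub>M M) (\<lambda>(x, y). h (y, x))"
    using P.integral_product_swap[of h] by simp
  also have "\<dots> = (\<integral>z. h z + (case z of (x, y) \<Rightarrow> h (y, x)) \<partial>(M \<Otimes>\<^sub>M M))"
    using h h' by (rule Bochner_Integration.integral_add[symmetric])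
  also have "\<dots> = (\<integral>z. (case z of (x, y) \<Rightarrow> K x y * (u x - u y)\<^sup>2) \<partial>(M \<Otimes>\<^sub>M M))"
    using sum by (intro Bochner_Integration.integral_cong) auto
  finally have eq: "2 * (\<integral>x. u x * (\<integral>y. K x y * (u x - u y) \<partial>M) \<partial>M) = \<dots>" .
  have "integrable (M \<Otimes>\<^sub>M M) (\<lambda>(x, y). K x y * (u x - u y)\<^sup>2)"
    using Bochner_Integration.integrable_add[OF h h'] sum
    by (subst Bochner_Integration.integrable_cong[OF refl]) (auto split: prod.splits)
  then have "ennreal (\<integral>z. (case z of (x, y) \<Rightarrow> K x y * (u x - u y)\<^sup>2) \<partial>(M \<Otimes>\<^sub>M M)) =
      (\<integral>\<^sup>+z. ennreal (case z of (x, y) \<Rightarrow> K x y * (u x - u y)\<^sup>2) \<partial>(M \<Otimes>\<^sub>M M))"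
    using K(2) by (intro nn_integral_eq_integral[symmetric]) auto
  also have "\<dots> = (\<integral>\<^sup>+x. \<integral>\<^sup>+y. ennreal (K x y * (u x - u y)\<^sup>2) \<partial>M \<partial>M)"
    by (subst nn_integral_fst[symmetric]) auto
  finally show "ennreal (2 * (\<integral>x. u x * (\<integral>y. K x y * (u x - u y) \<partial>M) \<partial>M)) =
      (\<integral>\<^sup>+x. \<integral>\<^sup>+y. ennreal (K x y * (u x - u y)\<^sup>2) \<partial>M \<partial>M)"
    unfolding eq .
  \<comment> \<open>Nonnegativity is proved separately because \<open>ennreal\<close> sends negative
    reals to 0, so the identity alone would not exclude them.\<close>
  have "0 \<le> (\<integral>z. (case z of (x, y) \<Rightarrow> K x y * (u x - u y)\<^sup>2) \<partial>(M \<Otimes>\<^sub>M M))"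
    using K(2) by (intro Bochner_Integration.integral_nonneg) auto
  then show "0 \<le> (\<integral>x. u x * (\<integral>y. K x y * (u x - u y) \<partial>M) \<partial>M)"
    using eq by linarith
qed

lemma admissible_kernel_properties:
  assumes "admissible_kernel R"
  obtains \<delta> c where "\<delta> > 0" "\<And>r. 0 \<le> r \<Longrightarrow> r \<le> 1 / 2 \<Longrightarrow> \<delta> \<le> R r" "\<And>r. 0 \<le> r \<Longrightarrow> R r \<le> c"
    "\<And>r. 0 \<le> r \<Longrightarrow> 0 \<le> R r" "continuous_on {0..} R"
proof -
  obtain R' where "\<And>r. r \<ge> 0 \<Longrightarrow> (R has_real_derivative R' r) (at r within {0..})"
    using assms unfolding admissible_kernel_def by metis
  then have cont: "continuous_on {0..} R"
    by (auto simp: continuous_on_eq_continuous_within intro: DERIV_continuous)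
  have pos: "\<And>r. 0 \<le> r \<Longrightarrow> 0 \<le> R r" and zero: "\<And>r. r > 1 \<Longrightarrow> R r = 0"
    and "\<exists>\<delta>>0. \<forall>r. 0 \<le> r \<and> r \<le> 1 / 2 \<longrightarrow> R r \<ge> \<delta>"
    using assms by (simp_all add: admissible_kernel_def)
  then obtain \<delta> where \<delta>: "\<delta> > 0" "\<And>r. 0 \<le> r \<Longrightarrow> r \<le> 1 / 2 \<Longrightarrow> \<delta> \<le> R r"
    by auto
  \<comment> \<open>The maximum over \<open>{0..1}\<close> bounds \<open>R\<close> everywhere on the
    half-line, because beyond 1 it is 0 and the maximum is nonnegative.\<close>
  obtain r1 where r1: "r1 \<in> {0..1}" "\<And>r. r \<in> {0..1} \<Longrightarrow> R r \<le> R r1"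
    using continuous_attains_sup[OF _ _ continuous_on_subset[OF cont, of "{0..1}"]] by auto
  have "R r \<le> R r1" if "r \<ge> 0" for r
    using r1 zero[of r] pos[of r1] that by (cases "r \<le> 1") auto
  then show thesis using that[OF \<delta> _ pos cont] by blast
qed

lemma
  fixes t :: real
  assumes "admissible_kernel R" "t > 0"
  shows R_t_nonneg: "0 \<le> R_t k R t x y" and R_t_commute: "R_t k R t x y = R_t k R t y x"
    and R_t_measurable: "(\<lambda>(x, y). R_t k R t x y) \<in> borel_measurable (borel \<Otimes>\<^sub>M (borel :: 'a::euclidean_space measure))"
    and R_t_bounded: "\<exists>c. \<forall>x y :: 'a. R_t k R t x y \<le> c"
    and R_t_lower: "\<exists>\<delta>>0. \<forall>t>0. \<forall>x y :: 'a. (norm (x - y))\<^sup>2 \<le> 2 * t \<longrightarrow> \<delta> * C_t k t \<le> R_t k R t x y"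
proof -
  obtain \<delta> c where \<delta>: "\<delta> > 0" "\<And>r. 0 \<le> r \<Longrightarrow> r \<le> 1 / 2 \<Longrightarrow> \<delta> \<le> R r" and c: "\<And>r. 0 \<le> r \<Longrightarrow> R r \<le> c"
    and pos: "\<And>r. 0 \<le> r \<Longrightarrow> 0 \<le> R r" and cont: "continuous_on {0..} R"
    using admissible_kernel_properties[OF assms(1)] by blast
  have C: "0 < C_t k t" if "t > 0" for t by (rule C_t_pos[OF that])
  show "0 \<le> R_t k R t x y" using C[OF assms(2)] assms(2) pos by (auto simp: R_t_def intro!: mult_nonneg_nonneg)
  show "R_t k R t x y = R_t k R t y x" by (simp add: R_t_def norm_minus_commute)
  \<comment> \<open>\<open>R\<close> is arbitrary on negative arguments; the truncation is Borel and
    agrees with it at every argument that occurs.\<close>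
  define R0 where "R0 r = (if r \<in> {0..} then R r else 0)" for r
  have [measurable]: "R0 \<in> borel_measurable borel" unfolding R0_def
    by (intro borel_measurable_continuous_on_if cont continuous_on_const) auto
  have "(\<lambda>(x :: 'a, y). R_t k R t x y) = (\<lambda>(x, y). C_t k t * R0 ((norm (x - y))\<^sup>2 / (4 * t)))"
    using assms(2) by (auto simp: R_t_def R0_def)
  then show "(\<lambda>(x :: 'a, y). R_t k R t x y) \<in> borel_measurable (borel \<Otimes>\<^sub>M borel)" by simp
  have "R_t k R t x y \<le> C_t k t * c" for x y :: 'a
    using C[OF assms(2)] assms(2) unfolding R_t_def by (intro mult_left_mono c) auto
  then show "\<exists>c. \<forall>x y :: 'a. R_t k R t x y \<le> c" by blast
  have "\<delta> * C_t k t \<le> R_t k R t x y" if "t > 0" "(norm (x - y))\<^sup>2 \<le> 2 * t" for t and x y :: 'a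
  proof -
    have "C_t k t * \<delta> \<le> R_t k R t x y"
      unfolding R_t_def using that C[OF that(1)] by (intro mult_left_mono \<delta>(2)) (auto simp: field_simps)
    then show ?thesis by (simp add: mult.commute)
  qed
  then show "\<exists>\<delta>>0. \<forall>t>0. \<forall>x y :: 'a. (norm (x - y))\<^sup>2 \<le> 2 * t \<longrightarrow> \<delta> * C_t k t \<le> R_t k R t x y"
    using \<delta>(1) by blast
qed

theorem theorem6:
  fixes M :: "(real^'d) set" and \<mu> :: "(real^'d) measure" and R :: "real \<Rightarrow> real"
  assumes "smooth_submanifold_with_boundary TYPE('k::finite) M"
    and "compact M" and "connected M"
    and "is_volume_measure TYPE('k) M \<mu>"
    and "admissible_kernel R"
  shows "\<exists>C>0. \<exists>t0>0. \<forall>t. 0 < t \<and> t < t0 \<longrightarrow>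
           (\<forall>u. u \<in> borel_measurable \<mu> \<and> integrable \<mu> (\<lambda>x. (u x)\<^sup>2) \<and> (\<integral>x. u x \<partial>\<mu>) = 0 \<longrightarrow>
              (\<integral>x. u x * L_t CARD('k) R \<mu> t u x \<partial>\<mu>) \<ge> C * (\<integral>x. (u x)\<^sup>2 \<partial>\<mu>))"
proof (cases "M = {}")
  case True
  \<comment> \<open>For empty \<open>M\<close> the measure is zero and both sides of the inequality
    vanish.\<close>
  have "emeasure \<mu> UNIV = 0" using assms(4) True by (simp add: is_volume_measure_def)
  moreover have "space \<mu> = UNIV"
    using assms(4) sets_eq_imp_space_eq[of \<mu> borel] by (simp add: is_volume_measure_def)
  ultimately have "AE x in \<mu>. False"
    using sets.top[of \<mu>] by (intro AE_I[of _ _ UNIV]) auto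
  then have "integral\<^sup>L \<mu> f = 0" for f :: "real^'d \<Rightarrow> real"
    by (intro integral_eq_zero_AE) auto
  then show ?thesis by (auto intro!: exI[of _ 1])
next
  case False
  define k where "k = CARD('k)"
  have M: "M \<in> sets borel" using \<open>compact M\<close> by (rule borel_compact)
  have sets [measurable_cong]: "sets \<mu> = sets borel" and null: "emeasure \<mu> (- M) = 0"
    using assms(4) by (auto simp: is_volume_measure_def)
  have space: "space \<mu> = UNIV" using sets_eq_imp_space_eq[OF sets] by simp
  interpret finite_measure \<mu> by (rule finite_measure_volume_measure[OF assms(1,2,4)])
  have pos: "0 < measure \<mu> A" if A: "openin (top_of_set M) A" "A \<noteq> {}" for A
  proof -
    obtain p T where T: "A = M \<inter> T" "open T" "p \<in> M" "p \<in> T" using A by (auto simp: openin_open)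
    obtain Q where Q: "openin (top_of_set M) Q" "Q \<subseteq> T" "0 < emeasure \<mu> Q"
      using volume_measure_patch[OF assms(1) M assms(4) T(3,4,2)] by metis
    have "emeasure \<mu> Q \<le> emeasure \<mu> A"
      using Q(1,2) T M sets by (intro emeasure_mono) (auto dest: openin_imp_subset)
    then have "0 < emeasure \<mu> A" using Q(3) by order
    then show ?thesis by (simp add: emeasure_eq_measure)
  qed
  have "controlled k \<mu> M M"
    using assms(1-4) M pos finite_measure_axioms sets unfolding k_def
    by (intro controlled_compact_connected volume_measure_controlled_patch) auto
  then obtain C t0 where C: "C \<ge> 0" "t0 > 0" and ctrl: "\<And>t u. 0 < t \<Longrightarrow> t < t0 \<Longrightarrow> u \<in> borel_measurable borel \<Longrightarrow>
      sq_osc \<mu> u M M \<le> ennreal (C * C_t k t / t) * near_osc \<mu> t u"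
    unfolding controlled_def by blast
  \<comment> \<open>The lower bound quantifies over its own \<open>t\<close>, so \<delta> is
    uniform; the value 1 only discharges the positivity premise.\<close>
  obtain \<delta> where \<delta>: "\<delta> > 0" "\<And>t (x::real^'d) y. t > 0 \<Longrightarrow> (norm (x - y))\<^sup>2 \<le> 2 * t \<Longrightarrow> \<delta> * C_t k t \<le> R_t k R t x y"
    using R_t_lower[OF assms(5), of 1 k] by auto
  have m: "measure \<mu> M > 0" using pos[of M] False by simp
  define m where "m = measure \<mu> UNIV"
  have "m > 0" using m finite_measure_mono[of M UNIV] sets unfolding m_def by simp
  show ?thesis
  \<comment> \<open>\<delta> is the kernel lower bound, \<open>m\<close> the factor from the
    variance identity. The denominator is \<open>C + 1\<close> because \<open>C\<close> may be 0;
    the extra \<open>E\<close> this costs is nonnegative.\<close>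
  proof (rule exI[of _ "\<delta> * m / (C + 1)"], rule conjI[OF _ exI[of _ t0]], goal_cases)
    case 1
    show ?case using \<delta>(1) \<open>m > 0\<close> C(1) by simp
  next
    case 2
    show ?case
    proof (intro conjI allI impI)
      show "t0 > 0" by (rule C(2))
      fix t :: real and u :: "real^'d \<Rightarrow> real" assume t: "0 < t \<and> t < t0"
        and "u \<in> borel_measurable \<mu> \<and> integrable \<mu> (\<lambda>x. (u x)\<^sup>2) \<and> (\<integral>x. u x \<partial>\<mu>) = 0"
      then have u\<mu>: "u \<in> borel_measurable \<mu>"
        and u2: "integrable \<mu> (\<lambda>x. (u x)\<^sup>2)" and u0: "(\<integral>x. u x \<partial>\<mu>) = 0"
        by blast+
      have [measurable]: "u \<in> borel_measurable borel"
        using u\<mu> unfolding measurable_cong_sets[OF sets refl] .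
      have u1: "integrable \<mu> u"
        by (rule square_integrable_imp_integrable[OF u\<mu> u2])
      define E where "E = (\<integral>x. u x * L_t k R \<mu> t u x \<partial>\<mu>)"
      define D where "D = (\<integral>x. u x * (\<integral>y. R_t k R t x y * (u x - u y) \<partial>\<mu>) \<partial>\<mu>)"
      have ED: "E = D / t" unfolding E_def D_def L_t_def by simp
      obtain c where c: "\<And>x y :: real^'d. R_t k R t x y \<le> c"
        using R_t_bounded[OF assms(5), of t k] t by blast
      have Rm: "(\<lambda>(x, y). R_t k R t x y) \<in> borel_measurable (\<mu> \<Otimes>\<^sub>M \<mu>)"
        unfolding measurable_cong_sets[OF sets_pair_measure_cong[OF sets sets] refl]
        using R_t_measurable[OF assms(5)] t by blast
      note id = dirichlet_form_identity[OF finite_measure_axioms u\<mu> u2 Rm R_t_commute[OF assms(5)] R_t_nonneg[OF assms(5)] c,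
          OF conjunct1[OF t] conjunct1[OF t], folded D_def]
      have "ennreal (\<delta> * C_t k t) * near_osc \<mu> t u =
        (\<integral>\<^sup>+x. \<integral>\<^sup>+y. ennreal (\<delta> * C_t k t) * (ennreal ((u x - u y)\<^sup>2) * indicator {y. (norm (x - y))\<^sup>2 \<le> 2 * t} y) \<partial>\<mu> \<partial>\<mu>)"
        unfolding near_osc_def by (simp add: nn_integral_cmult)
      also have "\<dots> \<le> (\<integral>\<^sup>+x. \<integral>\<^sup>+y. ennreal (R_t k R t x y * (u x - u y)\<^sup>2) \<partial>\<mu> \<partial>\<mu>)"
      proof (intro nn_integral_mono)
        fix x y
        show "ennreal (\<delta> * C_t k t) * (ennreal ((u x - u y)\<^sup>2) * indicator {y. (norm (x - y))\<^sup>2 \<le> 2 * t} y) \<le>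
          ennreal (R_t k R t x y * (u x - u y)\<^sup>2)"
          using \<delta>(2)[of t x y] t R_t_nonneg[OF assms(5), of t k x y]
          by (auto simp: indicator_def ennreal_mult intro!: mult_right_mono ennreal_leI)
      qed
      also have "\<dots> = ennreal (2 * D)" using id(1) by simp
      finally have lower: "ennreal (\<delta> * C_t k t) * near_osc \<mu> t u \<le> ennreal (2 * D)" .
      \<comment> \<open>The only use of the zero mean: the inner integral reduces to
        \<open>m * u x\<close>.\<close>
      have "(\<integral>x. u x * (\<integral>y. 1 * (u x - u y) \<partial>\<mu>) \<partial>\<mu>) = m * (\<integral>x. (u x)\<^sup>2 \<partial>\<mu>)"
      proof -
        have "u x * (\<integral>y. 1 * (u x - u y) \<partial>\<mu>) = m * (u x)\<^sup>2" for x
          using u1 u0 by (simp add: m_def space power2_eq_square)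
        then show ?thesis by simp
      qed
      then have "ennreal (2 * (m * (\<integral>x. (u x)\<^sup>2 \<partial>\<mu>))) = (\<integral>\<^sup>+x. \<integral>\<^sup>+y. ennreal ((u x - u y)\<^sup>2) \<partial>\<mu> \<partial>\<mu>)"
        using dirichlet_form_identity(1)[OF finite_measure_axioms u\<mu> u2, of "\<lambda>_ _. 1" 1] by simp
      also have "\<dots> = sq_osc \<mu> u M M"
      proof -
        have "- M \<in> null_sets \<mu>" using null M sets by auto
        then have "AE x in \<mu>. x \<notin> - M" by (rule AE_not_in)
        then have AE: "AE x in \<mu>. x \<in> M" by simp
        have on_M: "(\<integral>\<^sup>+y. g y \<partial>\<mu>) = (\<integral>\<^sup>+y\<in>M. g y \<partial>\<mu>)" for g
          using AE by (intro nn_integral_cong_AE) (auto elim!: eventually_mono)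
        show ?thesis unfolding sq_osc_def on_M[symmetric] ..
      qed
      also have "\<dots> \<le> ennreal (C * C_t k t / t) * near_osc \<mu> t u"
        using t by (intro ctrl) auto
      finally have upper: "ennreal (2 * (m * (\<integral>x. (u x)\<^sup>2 \<partial>\<mu>))) \<le> ennreal (C * C_t k t / t) * near_osc \<mu> t u" .
      have "ennreal (\<delta> * (2 * (m * (\<integral>x. (u x)\<^sup>2 \<partial>\<mu>)))) = ennreal \<delta> * ennreal (2 * (m * (\<integral>x. (u x)\<^sup>2 \<partial>\<mu>)))"
        using \<delta>(1) by (intro ennreal_mult') auto
      also have "\<dots> \<le> ennreal \<delta> * (ennreal (C * C_t k t / t) * near_osc \<mu> t u)"
        by (intro mult_left_mono upper) simp
      also have "\<dots> = ennreal (C / t) * (ennreal (\<delta> * C_t k t) * near_osc \<mu> t u)"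
      proof -
        have "ennreal \<delta> * ennreal (C * C_t k t / t) = ennreal (C / t) * ennreal (\<delta> * C_t k t)"
          using \<delta>(1) C(1) t C_t_pos[of t k] by (simp add: ennreal_mult[symmetric] mult_ac)
        then show ?thesis by (simp only: mult.assoc[symmetric])
      qed
      also have "\<dots> \<le> ennreal (C / t) * ennreal (2 * D)"
        by (intro mult_left_mono lower) simp
      also have "\<dots> = ennreal (C / t * (2 * D))"
        using C(1) t by (intro ennreal_mult'[symmetric]) auto
      \<comment> \<open>Returning from \<open>ennreal\<close> to reals needs the right-hand side to
        be nonnegative, which is \<open>id(2)\<close>.\<close>
      finally have "\<delta> * (2 * (m * (\<integral>x. (u x)\<^sup>2 \<partial>\<mu>))) \<le> C / t * (2 * D)"
        using id(2) C(1) t by (subst (asm) ennreal_le_iff) auto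
      also have "\<dots> = 2 * (C * E)" using ED by simp
      finally have "\<delta> * m * (\<integral>x. (u x)\<^sup>2 \<partial>\<mu>) \<le> C * E" by (simp add: mult.assoc)
      moreover have "E \<ge> 0" using id(2) t ED by simp
      ultimately have "\<delta> * m * (\<integral>x. (u x)\<^sup>2 \<partial>\<mu>) \<le> E * (C + 1)" by (simp add: algebra_simps)
      then show "(\<integral>x. u x * L_t CARD('k) R \<mu> t u x \<partial>\<mu>) \<ge> \<delta> * m / (C + 1) * (\<integral>x. (u x)\<^sup>2 \<partial>\<mu>)"
        using C(1) by (simp add: E_def[unfolded k_def, symmetric] field_simps)
    qed
  qed
qed

end
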